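(* Let $X\times S$ be a monotonely cancellative $\mathbf P$-quasisemilinear preordered space, let $p:X\times S\to(-\infty,\infty]$ be sublinear, let $E$ be a $\mathbf P$-quasisemilinear subspace of $X\times S$, and let $g:E\to\mathbb R$ be semilinear on $E$. If $\xi=\xi_{p,g}$ is a sublinear map of moderate variation, then for each subset $W$ of $X\times S$ there exists a $W$-maximal monotone Hahn-Banach extension of $g$.
   Context: **Setting.** $\mathbb K$ is $\mathbb Q$, $\mathbb R$ or $\mathbb C$; $\mathbb K^*=\mathbb K\setminus\{0\}$, $\mathbb K_+=\mathbb K\cap(0,\infty)$; $\mathbf P$ is either $\mathbb K^*$ or $\mathbb K_+$. $X$ is a topological vector space over $\mathbb K$ and $S$ is a family of subsets of $X$, with an addition $\hat+$ on $S$ and a preorder $\le$ on $S$ (basic case: inclusion; more generally an abstract preorder). $X\times S$ is a *$\mathbf P$-quasisemilinear preordered space* if: (1) $\emptyset\in S$; (2) $(S,\hat+)$ is a commutative semigroup with zero element $\emptyset$; (3) $\le$ is reflexive and transitive, $A_1\le B_1$ and $A_2\le B_2$ imply $A_1\hat+A_2\le B_1\hat+B_2$, and $A\hat+B\le C\hat+B$ and $B\le G$ imply $A\hat+G\le C\hat+G$; (4) for $a,b\in\mathbf P$, $A,B\in S$: $aA\in S$, $a(A\hat+B)=aA\hat+aB$, $(ab)A=a(bA)$, $1A=A$; (5) $v+A\in S$ for $v\in X$, $A\in S$. The standing list also includes the properties (presented as consequences): (6) $aA=aB$ for some $a\in\mathbf P$ implies $A=B$; (7) $A\le B$ implies $aA\le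 aB$ for $a\in\mathbf P$; (8) $A\le A\hat+B$ if $0\in B$. On $X\times S$: $(x,A)+(y,B)=(x+y,A\hat+B)$, $a(x,A)=(ax,aA)$, and $(x,A)\le(y,B)$ iff $x=y$ and $A\le B$. For $k\in\mathbb N$, $k\circ A=A\hat+\cdots\hat+A$ ($k$ terms). $X\times S$ is *monotonely cancellative* if $A\hat+B\le A'\hat+B$ implies $A\le A'$ in $S$. A *$\mathbf P$-quasisemilinear subspace* is a subset which with the induced operations satisfies conditions (1) (containing $\emptyset$ in the $S$-component), (2) (being a commutative semigroup with zero element under addition), (4) (closure under multiplication by scalars $a\in\mathbf P$, with the identities $a(A\hat+B)=aA\hat+aB$, $(ab)A=a(bA)$, $1A=A$), (5) (shift-invariance) and (6) ($aA=aB$ for some $a\in\mathbf P$ implies $A=B$), i.e. all of (1)–(8) except the preorder conditions (3), (7), (8), shift-invariance being required for vectors of its projection to $X$; the basic case is $E=H\times F$ with $H$ a linear subspace of $X$ and $F\subset S$ satisfying conditions (1)–(8) with $H$ in place of $X$. **Maps.** A map $f$ with values in $[-\infty,\infty]$ on $X\times S$ is *sublinear* if (S1) $f(0,\emptyset)=0$; (S2) $f(v+x,v+A)=f(x,A)$ for all $v,x\in X$, $A\in S$; (S3) $f(x+y,\emptyset)\le f(x,\emptyset)+f(y,\emptyset)$; (S4) $f(0,A\hat+B)\le f(0,A)+f(0,B)$ (with $\infty+(-\infty)=\infty$); (S5) $f(0,aA)=af(0,A)$ for $a\in\mathbb K_+$. It is *semilinear* if (S1), (S2), (S5) hold, $x\mapsto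 f(x,\emptyset)$ is linear, $f(0,A\hat+B)=f(0,A)+f(0,B)$, and $f$ takes at most one of the values $-\infty,\infty$; the same term is used for maps on subspaces $E$. In inequalities $\sum a_i\le\sum b_j$, $\infty-\infty$ means $-\infty$ on the left side and $\infty$ on the right side. $f$ is *monotone* if $(x,A)\le(y,B)$ implies $f(x,A)\le f(y,B)$. A *monotone Hahn-Banach extension* of $g$ is an extension $h:X\times S\to(-\infty,\infty]$ of $g$ that is semilinear, monotone and satisfies $h\le p$. For $W\subset X\times S$, a monotone Hahn-Banach extension $h$ of $g$ is *$W$-maximal* if for each monotone Hahn-Banach extension $h'$ of $g$, $h'\ge h$ on $W$ implies $h'=h$ on $W$. **Function $\xi$.** A *test relation* for $(x,A)\in X\times S$ consists of $y+nx=l+m$ and $B\hat+n_1\circ(a_1A)\hat+\cdots\hat+n_k\circ(a_kA)\hat+C\le J\hat+G\hat+C$, with $m\in X$, $(y,B),(l,J)\in E$, $G,C\in S$, $k\in\mathbb N$, integers $n_i>0$, $a_i\in\mathbb K_+$, $n=n_1a_1+\cdots+n_ka_k$. Then $\xi_{p,g}(x,A)$ is the infimum of $n^{-1}(p(m,G)+g(l,J)-g(y,B))$ over all test relations for $(x,A)$. A sublinear map $\xi:X\times S\to(-\infty,\infty]$ is *of moderate variation* if $\inf\{\xi(x+y,A\hat+B)-\xi(y,B):(y,B)\in X\times S\}>-\infty$ for all $(x,A)\in X\times S$.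
   Formalization: Added, since the claim fails without them: addition is compatible with translations, v+(A+̂B)=(v+A)+̂B for nonempty A; and semilinearity of g on E includes additivity and K_+-homogeneity on pairs (x,A) of E. *)

theory Defs
  imports "HOL-Analysis.Analysis"
begin

text \<open>
  The scalar field is the subset \<open>\<rat>\<close>, \<open>\<real>\<close> or \<open>UNIV\<close> of \<^typ>\<open>complex\<close>, and \<open>vscale\<close> is only
  constrained on scalars from it. The topology of the vector space is that of the type \<open>'x\<close>.
\<close>

definition topological_vector_space_over ::
  "complex set \<Rightarrow> (complex \<Rightarrow> 'x::topological_ab_group_add \<Rightarrow> 'x) \<Rightarrow> bool" where
  "topological_vector_space_over K vscale \<longleftrightarrow>
     (\<forall>a\<in>K. \<forall>x y. vscale a (x + y) = vscale a x + vscale a y) \<and>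
     (\<forall>a\<in>K. \<forall>b\<in>K. \<forall>x. vscale (a + b) x = vscale a x + vscale b x) \<and>
     (\<forall>a\<in>K. \<forall>b\<in>K. \<forall>x. vscale (a * b) x = vscale a (vscale b x)) \<and>
     (\<forall>x. vscale 1 x = x) \<and>
     continuous_on (K \<times> UNIV) (\<lambda>(a, x). vscale a x)"

text \<open>
  The component \<open>void\<close> gives \<open>v + {}\<close>: this is \<open>{}\<close> if the translate is read as an image, and
  \<open>{v}\<close> if \<open>{}\<close> is read as the zero element of the addition of sets, as it is for \<open>hadd\<close>.
  Both readings are admitted below. Under the first one, translation invariance makes
  \<open>f (x, {})\<close> vanish for every sublinear \<open>f\<close> and all \<open>x\<close>.
\<close>

record 'x qspace =
  scalars :: "complex set"
  pscalars :: "complex set"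
  vscale :: "complex \<Rightarrow> 'x \<Rightarrow> 'x"
  family :: "'x set set"
  hadd :: "'x set \<Rightarrow> 'x set \<Rightarrow> 'x set"  (infixl "\<boxplus>\<index>" 65)
  hle :: "'x set \<Rightarrow> 'x set \<Rightarrow> bool"  (infix "\<sqsubseteq>\<index>" 50)
  void :: "'x \<Rightarrow> 'x set"

definition hscale :: "('x, 'm) qspace_scheme \<Rightarrow> complex \<Rightarrow> 'x set \<Rightarrow> 'x set" where
  "hscale M a A = vscale M a ` A"

definition translate :: "('x::plus, 'm) qspace_scheme \<Rightarrow> 'x \<Rightarrow> 'x set \<Rightarrow> 'x set" where
  "translate M v A = (if A = {} then void M v else (\<lambda>x. v + x) ` A)"

definition points :: "('x, 'm) qspace_scheme \<Rightarrow> ('x \<times> 'x set) set" where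
  "points M = UNIV \<times> family M"

definition padd ::
  "('x::plus, 'm) qspace_scheme \<Rightarrow> 'x \<times> 'x set \<Rightarrow> 'x \<times> 'x set \<Rightarrow> 'x \<times> 'x set" where
  "padd M z w = (fst z + fst w, snd z \<boxplus>\<^bsub>M\<^esub> snd w)"

definition pscale ::
  "('x, 'm) qspace_scheme \<Rightarrow> complex \<Rightarrow> 'x \<times> 'x set \<Rightarrow> 'x \<times> 'x set" where
  "pscale M a z = (vscale M a (fst z), hscale M a (snd z))"

definition ple ::
  "('x, 'm) qspace_scheme \<Rightarrow> 'x \<times> 'x set \<Rightarrow> 'x \<times> 'x set \<Rightarrow> bool" where
  "ple M z w \<longleftrightarrow> fst z = fst w \<and> snd z \<sqsubseteq>\<^bsub>M\<^esub> snd w"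

definition posreals :: "('x, 'm) qspace_scheme \<Rightarrow> real set" where
  "posreals M = {r. 0 < r \<and> complex_of_real r \<in> scalars M}"

text \<open>
  The condition on \<open>translate M v (A \<boxplus>\<^bsub>M\<^esub> B)\<close> makes \<open>hadd\<close> compatible with translations, as for
  Minkowski sums and their closed or convex hulls. The source leaves it tacit. Without it, \<open>hadd\<close>
  and \<open>hle\<close> are unrelated to the translates under which sublinear maps are invariant, and a
  monotone Hahn-Banach extension need not exist.
\<close>

definition quasisemilinear_preordered_space ::
  "('x::topological_ab_group_add, 'm) qspace_scheme \<Rightarrow> bool" where
  "quasisemilinear_preordered_space M \<longleftrightarrow>
     scalars M \<in> {\<rat>, \<real>, UNIV} \<and>
     pscalars M \<in> {scalars M - {0}, complex_of_real ` posreals M} \<and>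
     topological_vector_space_over (scalars M) (vscale M) \<and>
     void M \<in> {\<lambda>v. {}, \<lambda>v. {v}} \<and>
     {} \<in> family M \<and>
     (\<forall>A\<in>family M. \<forall>B\<in>family M. A \<boxplus>\<^bsub>M\<^esub> B \<in> family M) \<and>
     (\<forall>A\<in>family M. \<forall>B\<in>family M. \<forall>C\<in>family M. (A \<boxplus>\<^bsub>M\<^esub> B) \<boxplus>\<^bsub>M\<^esub> C = A \<boxplus>\<^bsub>M\<^esub> (B \<boxplus>\<^bsub>M\<^esub> C)) \<and>
     (\<forall>A\<in>family M. \<forall>B\<in>family M. A \<boxplus>\<^bsub>M\<^esub> B = B \<boxplus>\<^bsub>M\<^esub> A) \<and>
     (\<forall>A\<in>family M. A \<boxplus>\<^bsub>M\<^esub> {} = A) \<and>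
     (\<forall>A\<in>family M. A \<sqsubseteq>\<^bsub>M\<^esub> A) \<and>
     (\<forall>A\<in>family M. \<forall>B\<in>family M. \<forall>C\<in>family M. A \<sqsubseteq>\<^bsub>M\<^esub> B \<and> B \<sqsubseteq>\<^bsub>M\<^esub> C \<longrightarrow> A \<sqsubseteq>\<^bsub>M\<^esub> C) \<and>
     (\<forall>A1\<in>family M. \<forall>B1\<in>family M. \<forall>A2\<in>family M. \<forall>B2\<in>family M.
        A1 \<sqsubseteq>\<^bsub>M\<^esub> B1 \<and> A2 \<sqsubseteq>\<^bsub>M\<^esub> B2 \<longrightarrow> A1 \<boxplus>\<^bsub>M\<^esub> A2 \<sqsubseteq>\<^bsub>M\<^esub> B1 \<boxplus>\<^bsub>M\<^esub> B2) \<and>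
     (\<forall>A\<in>family M. \<forall>B\<in>family M. \<forall>C\<in>family M. \<forall>G\<in>family M.
        A \<boxplus>\<^bsub>M\<^esub> B \<sqsubseteq>\<^bsub>M\<^esub> C \<boxplus>\<^bsub>M\<^esub> B \<and> B \<sqsubseteq>\<^bsub>M\<^esub> G \<longrightarrow> A \<boxplus>\<^bsub>M\<^esub> G \<sqsubseteq>\<^bsub>M\<^esub> C \<boxplus>\<^bsub>M\<^esub> G) \<and>
     (\<forall>a\<in>pscalars M. \<forall>A\<in>family M. hscale M a A \<in> family M) \<and>
     (\<forall>a\<in>pscalars M. \<forall>A\<in>family M. \<forall>B\<in>family M.
        hscale M a (A \<boxplus>\<^bsub>M\<^esub> B) = hscale M a A \<boxplus>\<^bsub>M\<^esub> hscale M a B) \<and>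
     (\<forall>a\<in>pscalars M. \<forall>b\<in>pscalars M. \<forall>A\<in>family M. hscale M (a * b) A = hscale M a (hscale M b A)) \<and>
     (\<forall>A\<in>family M. hscale M 1 A = A) \<and>
     (\<forall>v. \<forall>A\<in>family M. translate M v A \<in> family M) \<and>
     (\<forall>v. \<forall>A\<in>family M. \<forall>B\<in>family M. A \<noteq> {} \<longrightarrow>
        translate M v (A \<boxplus>\<^bsub>M\<^esub> B) = translate M v A \<boxplus>\<^bsub>M\<^esub> B) \<and>
     (\<forall>a\<in>pscalars M. \<forall>A\<in>family M. \<forall>B\<in>family M. hscale M a A = hscale M a B \<longrightarrow> A = B) \<and>
     (\<forall>a\<in>pscalars M. \<forall>A\<in>family M. \<forall>B\<in>family M. A \<sqsubseteq>\<^bsub>M\<^esub> B \<longrightarrow> hscale M a A \<sqsubseteq>\<^bsub>M\<^esub> hscale M a B) \<and>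
     (\<forall>A\<in>family M. \<forall>B\<in>family M. 0 \<in> B \<longrightarrow> A \<sqsubseteq>\<^bsub>M\<^esub> A \<boxplus>\<^bsub>M\<^esub> B)"

definition monotonely_cancellative :: "('x, 'm) qspace_scheme \<Rightarrow> bool" where
  "monotonely_cancellative M \<longleftrightarrow>
     (\<forall>A\<in>family M. \<forall>A'\<in>family M. \<forall>B\<in>family M. A \<boxplus>\<^bsub>M\<^esub> B \<sqsubseteq>\<^bsub>M\<^esub> A' \<boxplus>\<^bsub>M\<^esub> B \<longrightarrow> A \<sqsubseteq>\<^bsub>M\<^esub> A')"

text \<open>
  A zero element of \<open>E\<close> must be \<open>(0, {})\<close> once \<open>{}\<close> occurs as a second component. The algebraic
  identities and the injectivity of scaling are inherited from the ambient space.
\<close>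

definition quasisemilinear_subspace ::
  "('x::topological_ab_group_add, 'm) qspace_scheme \<Rightarrow> ('x \<times> 'x set) set \<Rightarrow> bool" where
  "quasisemilinear_subspace M E \<longleftrightarrow>
     E \<subseteq> points M \<and>
     (0, {}) \<in> E \<and>
     (\<forall>z\<in>E. \<forall>w\<in>E. padd M z w \<in> E) \<and>
     (\<forall>a\<in>pscalars M. \<forall>z\<in>E. pscale M a z \<in> E) \<and>
     (\<forall>v\<in>fst ` E. \<forall>A\<in>snd ` E. translate M v A \<in> snd ` E)"

text \<open>In \<^typ>\<open>ereal\<close>, \<open>\<infinity> + (-\<infinity>) = \<infinity>\<close> and \<open>\<infinity> - \<infinity> = \<infinity>\<close>.\<close>

definition sublinear ::
  "('x::topological_ab_group_add, 'm) qspace_scheme \<Rightarrow> ('x \<times> 'x set \<Rightarrow> ereal) \<Rightarrow> bool" where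
  "sublinear M f \<longleftrightarrow>
     f (0, {}) = 0 \<and>
     (\<forall>v x. \<forall>A\<in>family M. f (v + x, translate M v A) = f (x, A)) \<and>
     (\<forall>x y. f (x + y, {}) \<le> f (x, {}) + f (y, {})) \<and>
     (\<forall>A\<in>family M. \<forall>B\<in>family M. f (0, A \<boxplus>\<^bsub>M\<^esub> B) \<le> f (0, A) + f (0, B)) \<and>
     (\<forall>r\<in>posreals M. \<forall>A\<in>family M. f (0, hscale M (of_real r) A) = ereal r * f (0, A))"

text \<open>
  The values are extended reals, so linearity of \<open>x \<mapsto> f (x, {})\<close> means that it is finite, additive,
  and homogeneous for the real scalars of the field.
\<close>

definition semilinear_on ::
  "('x::topological_ab_group_add, 'm) qspace_scheme \<Rightarrow> ('x \<times> 'x set) set \<Rightarrow>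
   ('x \<times> 'x set \<Rightarrow> ereal) \<Rightarrow> bool" where
  "semilinear_on M D f \<longleftrightarrow>
     f (0, {}) = 0 \<and>
     (\<forall>v x A. (x, A) \<in> D \<and> (v + x, translate M v A) \<in> D \<longrightarrow>
        f (v + x, translate M v A) = f (x, A)) \<and>
     (\<forall>r\<in>posreals M. \<forall>A. (0, A) \<in> D \<and> (0, hscale M (of_real r) A) \<in> D \<longrightarrow>
        f (0, hscale M (of_real r) A) = ereal r * f (0, A)) \<and>
     (\<forall>x. (x, {}) \<in> D \<longrightarrow> \<bar>f (x, {})\<bar> \<noteq> \<infinity>) \<and>
     (\<forall>x y. (x, {}) \<in> D \<and> (y, {}) \<in> D \<and> (x + y, {}) \<in> D \<longrightarrow>
        f (x + y, {}) = f (x, {}) + f (y, {})) \<and>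
     (\<forall>r x. complex_of_real r \<in> scalars M \<and> (x, {}) \<in> D \<and> (vscale M (of_real r) x, {}) \<in> D \<longrightarrow>
        f (vscale M (of_real r) x, {}) = ereal r * f (x, {})) \<and>
     (\<forall>A B. (0, A) \<in> D \<and> (0, B) \<in> D \<and> (0, A \<boxplus>\<^bsub>M\<^esub> B) \<in> D \<longrightarrow>
        f (0, A \<boxplus>\<^bsub>M\<^esub> B) = f (0, A) + f (0, B)) \<and>
     \<not> (\<infinity> \<in> f ` D \<and> -\<infinity> \<in> f ` D)"

text \<open>
  A subspace \<open>E\<close> need not be a product and may contain no points \<open>(0, A)\<close> or \<open>(x, {})\<close> besides
  \<open>(0, {})\<close>, so semilinearity on \<open>E\<close> also refers to the operations of \<open>E\<close> on pairs.
\<close>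

definition semilinear_subspace_map ::
  "('x::topological_ab_group_add, 'm) qspace_scheme \<Rightarrow> ('x \<times> 'x set) set \<Rightarrow>
   ('x \<times> 'x set \<Rightarrow> real) \<Rightarrow> bool" where
  "semilinear_subspace_map M E g \<longleftrightarrow>
     semilinear_on M E (\<lambda>z. ereal (g z)) \<and>
     (\<forall>z\<in>E. \<forall>w\<in>E. g (padd M z w) = g z + g w) \<and>
     (\<forall>r\<in>posreals M. \<forall>z\<in>E. g (pscale M (of_real r) z) = r * g z)"

definition monotone_map ::
  "('x, 'm) qspace_scheme \<Rightarrow> ('x \<times> 'x set \<Rightarrow> ereal) \<Rightarrow> bool" where
  "monotone_map M f \<longleftrightarrow> (\<forall>z\<in>points M. \<forall>w\<in>points M. ple M z w \<longrightarrow> f z \<le> f w)"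

definition monotone_HB_extension ::
  "('x::topological_ab_group_add, 'm) qspace_scheme \<Rightarrow> ('x \<times> 'x set) set \<Rightarrow>
   ('x \<times> 'x set \<Rightarrow> ereal) \<Rightarrow> ('x \<times> 'x set \<Rightarrow> real) \<Rightarrow> ('x \<times> 'x set \<Rightarrow> ereal) \<Rightarrow> bool" where
  "monotone_HB_extension M E p g h \<longleftrightarrow>
     (\<forall>z\<in>points M. h z \<noteq> -\<infinity>) \<and>
     (\<forall>z\<in>E. h z = ereal (g z)) \<and>
     semilinear_on M (points M) h \<and>
     monotone_map M h \<and>
     (\<forall>z\<in>points M. h z \<le> p z)"

definition maximal_monotone_HB_extension ::
  "('x::topological_ab_group_add, 'm) qspace_scheme \<Rightarrow> ('x \<times> 'x set) set \<Rightarrow>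
   ('x \<times> 'x set \<Rightarrow> ereal) \<Rightarrow> ('x \<times> 'x set \<Rightarrow> real) \<Rightarrow> ('x \<times> 'x set) set \<Rightarrow>
   ('x \<times> 'x set \<Rightarrow> ereal) \<Rightarrow> bool" where
  "maximal_monotone_HB_extension M E p g W h \<longleftrightarrow>
     monotone_HB_extension M E p g h \<and>
     (\<forall>h'. monotone_HB_extension M E p g h' \<and> (\<forall>w\<in>W. h w \<le> h' w) \<longrightarrow> (\<forall>w\<in>W. h' w = h w))"

definition hmultiple :: "('x, 'm) qspace_scheme \<Rightarrow> nat \<Rightarrow> 'x set \<Rightarrow> 'x set" where
  "hmultiple M k A = (hadd M A ^^ k) {}"

text \<open>\<open>hcomb M [(n\<^sub>1, a\<^sub>1), \<dots>, (n\<^sub>k, a\<^sub>k)] A\<close> is the sum of the sets \<open>n\<^sub>i \<circ> (a\<^sub>i A)\<close>.\<close>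

definition hcomb :: "('x, 'm) qspace_scheme \<Rightarrow> (nat \<times> real) list \<Rightarrow> 'x set \<Rightarrow> 'x set" where
  "hcomb M ks A =
     foldr (\<lambda>(n, a) T. hmultiple M n (hscale M (of_real a) A) \<boxplus>\<^bsub>M\<^esub> T) ks {}"

definition test_relation ::
  "('x::topological_ab_group_add, 'm) qspace_scheme \<Rightarrow> ('x \<times> 'x set) set \<Rightarrow> 'x \<times> 'x set \<Rightarrow>
   real \<Rightarrow> 'x \<times> 'x set \<Rightarrow> 'x \<times> 'x set \<Rightarrow> 'x \<times> 'x set \<Rightarrow> bool" where
  "test_relation M E = (\<lambda>(x, A) n (y, B) (l, J) (m, G).
     (y, B) \<in> E \<and> (l, J) \<in> E \<and> G \<in> family M \<and>
     (\<exists>C\<in>family M. \<exists>ks. ks \<noteq> [] \<and> (\<forall>(k, a)\<in>set ks. 0 < k \<and> a \<in> posreals M) \<and>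
        n = (\<Sum>(k, a)\<leftarrow>ks. real k * a) \<and>
        y + vscale M (of_real n) x = l + m \<and>
        B \<boxplus>\<^bsub>M\<^esub> hcomb M ks A \<boxplus>\<^bsub>M\<^esub> C \<sqsubseteq>\<^bsub>M\<^esub> J \<boxplus>\<^bsub>M\<^esub> G \<boxplus>\<^bsub>M\<^esub> C))"

definition xi ::
  "('x::topological_ab_group_add, 'm) qspace_scheme \<Rightarrow> ('x \<times> 'x set) set \<Rightarrow>
   ('x \<times> 'x set \<Rightarrow> ereal) \<Rightarrow> ('x \<times> 'x set \<Rightarrow> real) \<Rightarrow> 'x \<times> 'x set \<Rightarrow> ereal" where
  "xi M E p g z =
     Inf {ereal (inverse n) * (p q + ereal (g c) - ereal (g b)) | n b c q. test_relation M E z n b c q}"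

definition sublinear_of_moderate_variation ::
  "('x::topological_ab_group_add, 'm) qspace_scheme \<Rightarrow> ('x \<times> 'x set \<Rightarrow> ereal) \<Rightarrow> bool" where
  "sublinear_of_moderate_variation M f \<longleftrightarrow>
     sublinear M f \<and> (\<forall>z\<in>points M. f z \<noteq> -\<infinity>) \<and>
     (\<forall>z\<in>points M. (INF w\<in>points M. f (padd M z w) - f w) > -\<infinity>)"

end

theory Submission
  imports Defs
begin

text \<open>
  A monotone semilinear map \<open>h\<close> on points is determined by \<open>A \<mapsto> h (0, A)\<close>, because translation invariance
  gives \<open>h (x, A) = h (0, - x + A)\<close>. So the extension problem is one about additive and homogeneous
  functionals on the commutative monoid of sets, which has no inverses. Substituting an extension
  into a test relation and cancelling shows that every monotone Hahn-Banach extension lies below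
  \<open>\<xi>\<close> (\<open>HB_extension_le_xi\<close>). What has to be found is therefore an additive functional below \<open>\<xi>\<close>.

  Without inverses, \<open>h \<le> \<xi>\<close> and \<open>\<xi> = g\<close> on \<open>E\<close> do not force \<open>h = g\<close> on \<open>E\<close>. What helps is that points of
  \<open>E\<close> are additive directions of \<open>\<xi>\<close>: by moving them from one side of a test relation to the other,
  one gets \<open>\<xi> (z + e) = \<xi> z + g e\<close> for every \<open>z\<close>, not only for \<open>z = 0\<close>. The proof uses the inequality \<open>\<ge>\<close>,
  which is \<open>xi_add_subspace_ge\<close>. The construction lowers a sublinear \<open>f\<close> until all directions are
  additive, and never changes its values on directions that are additive already. One step is the tilt
  \<open>f\<^sub>a z = inf (f (k z + l a) - l f a) / k\<close>, which makes \<open>a\<close> additive and keeps \<open>f a\<close>. Two facts make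
  it work.
    \<^item> Scaling is not additive in the scalar: \<open>(r + s) A\<close> and \<open>r A + s A\<close> differ. Here \<open>k\<close> and \<open>l\<close> therefore
      run over formal sums of scalars, acting by \<open>A \<mapsto> r\<^sub>1 A + \<dots> + r\<^sub>k A\<close>, as in the definition of \<open>\<xi>\<close>.
      These maps commute, and \<open>\<xi>\<close> is homogeneous for them.
    \<^item> Moderate variation gives finite \<open>q\<close> with \<open>q z + f w \<le> f (z + w)\<close>. A tilt, and an infimum of a
      chain, inherits this bound with the same \<open>q\<close>, so no value \<open>-\<infinity>\<close> appears; and a direction \<open>a\<close> with
      \<open>f a = \<infinity>\<close> is additive at once, so only finite directions need tilting.

  Zorn's lemma gives an \<open>f\<close> for which every direction of a given set is additive
  (\<open>extend_additive_elements\<close>). It is used twice. First the directions from \<open>W\<close> are made additive: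
  a linear \<open>h' \<le> f\<close> with \<open>f a \<le> h' a\<close> stays below the tilt \<open>f\<^sub>a\<close>, so every linear \<open>h'\<close> below the
  initial gauge that dominates the resulting \<open>f\<close> on \<open>W\<close> also satisfies \<open>h' \<le> f\<close>, and equals \<open>f\<close> on \<open>W\<close>.
  Then all remaining directions are made additive, which no longer affects the values on \<open>W\<close>
  (\<open>maximal_linear_minorant\<close>).

  The passage between points and sets depends on the meaning of \<open>v + {}\<close>. If it is \<open>{v}\<close>, one works with
  \<open>A \<mapsto> \<xi> (0, A)\<close>. If it is \<open>{}\<close>, then \<open>h (x, {}) = 0\<close> for all \<open>x\<close>, and monotonicity forces every
  extension to be translation invariant (\<open>nonneg_translation_invariant\<close>), so \<open>\<xi> (0, A)\<close> is replaced by the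
  infimum of all \<open>\<xi> (v, A)\<close>. Both cases are covered by the functional \<open>\<zeta>\<close>.
\<close>

section \<open>Infima of extended reals\<close>

lemma ereal_le_affine_iff:
  fixes x y :: ereal and n c :: real
  assumes "0 < n"
  shows "x \<le> ereal (inverse n) * (y - ereal c) \<longleftrightarrow> ereal n * x + ereal c \<le> y"
  using assms by (cases x; cases y) (auto simp: field_simps)

lemma ereal_mult_le_mult_iff_pos:
  fixes x y :: ereal and n :: real
  assumes "0 < n"
  shows "ereal n * x \<le> ereal n * y \<longleftrightarrow> x \<le> y"
  using assms by (cases x; cases y) auto

lemma le_Inf_plus_Inf:
  fixes x :: ereal
  assumes le: "\<And>v w. v \<in> V \<Longrightarrow> w \<in> U \<Longrightarrow> x \<le> v + w"
    and fin: "Inf V \<noteq> -\<infinity>" "Inf U \<noteq> -\<infinity>"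
  shows "x \<le> Inf V + Inf U"
proof (cases "Inf V = \<infinity> \<or> Inf U = \<infinity>")
  case True
  then show ?thesis using fin by auto
next
  case False
  then obtain a b where ab: "Inf V = ereal a" "Inf U = ereal b"
    using fin by (metis ereal_cases)
  show ?thesis
  proof (rule ereal_le_epsilon2)
    fix e :: real assume "0 < e"
    then have "Inf V < ereal (a + e / 2)" "Inf U < ereal (b + e / 2)"
      using ab by auto
    then obtain v w where vw: "v \<in> V" "w \<in> U" "v < ereal (a + e / 2)" "w < ereal (b + e / 2)"
      by (auto simp: Inf_less_iff)
    have "x \<le> v + w" using le vw by blast
    also have "\<dots> \<le> ereal (a + e / 2) + ereal (b + e / 2)"
      using vw by (intro add_mono) auto
    finally show "x \<le> Inf V + Inf U + ereal e" using ab by (simp add: ac_simps)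
  qed
qed

section \<open>Monoids with scaling by positive scalars\<close>

locale scaled_monoid =
  fixes S :: "'a set" and add :: "'a \<Rightarrow> 'a \<Rightarrow> 'a" (infixl "\<oplus>" 65)
    and zero :: 'a ("\<zero>") and Q :: "real set" and sc :: "real \<Rightarrow> 'a \<Rightarrow> 'a"
  assumes add_closed [simp, intro]: "A \<in> S \<Longrightarrow> B \<in> S \<Longrightarrow> A \<oplus> B \<in> S"
    and add_assoc: "A \<in> S \<Longrightarrow> B \<in> S \<Longrightarrow> C \<in> S \<Longrightarrow> (A \<oplus> B) \<oplus> C = A \<oplus> (B \<oplus> C)"
    and add_comm: "A \<in> S \<Longrightarrow> B \<in> S \<Longrightarrow> A \<oplus> B = B \<oplus> A"
    and zero_closed [simp, intro]: "\<zero> \<in> S"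
    and add_zero [simp]: "A \<in> S \<Longrightarrow> A \<oplus> \<zero> = A"
    and Q_pos: "r \<in> Q \<Longrightarrow> 0 < r"
    and Q_one [simp, intro]: "1 \<in> Q"
    and Q_mult [simp, intro]: "r \<in> Q \<Longrightarrow> s \<in> Q \<Longrightarrow> r * s \<in> Q"
    and Q_inverse [simp, intro]: "r \<in> Q \<Longrightarrow> inverse r \<in> Q"
    and sc_closed [simp, intro]: "r \<in> Q \<Longrightarrow> A \<in> S \<Longrightarrow> sc r A \<in> S"
    and sc_add: "r \<in> Q \<Longrightarrow> A \<in> S \<Longrightarrow> B \<in> S \<Longrightarrow> sc r (A \<oplus> B) = sc r A \<oplus> sc r B"
    and sc_mult: "r \<in> Q \<Longrightarrow> s \<in> Q \<Longrightarrow> A \<in> S \<Longrightarrow> sc (r * s) A = sc r (sc s A)"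
    and sc_one [simp]: "A \<in> S \<Longrightarrow> sc 1 A = A"
    and sc_zero [simp]: "r \<in> Q \<Longrightarrow> sc r \<zero> = \<zero>"
begin

lemma zero_add [simp]: "A \<in> S \<Longrightarrow> \<zero> \<oplus> A = A"
  by (metis add_comm add_zero zero_closed)

lemma add_left_comm:
  "A \<in> S \<Longrightarrow> B \<in> S \<Longrightarrow> C \<in> S \<Longrightarrow> A \<oplus> (B \<oplus> C) = B \<oplus> (A \<oplus> C)"
  by (metis add_assoc add_comm)

lemmas add_ac = add_assoc add_comm add_left_comm

text \<open>
  A list \<open>[r\<^sub>1, \<dots>, r\<^sub>k]\<close> of scalars stands for the formal sum that acts by \<open>A \<mapsto> r\<^sub>1 A + \<dots> + r\<^sub>k A\<close>. Since
  scaling does not distribute over sums of scalars, this is in general not the scaling by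
  \<open>sum_list [r\<^sub>1, \<dots>, r\<^sub>k]\<close>, but every additive and homogeneous functional treats the two alike.
  Lists in \<open>weights\<close> are nonempty, so that their sum is positive.
\<close>

definition comb :: "real list \<Rightarrow> 'a \<Rightarrow> 'a" where
  "comb rs A = foldr (\<lambda>r T. sc r A \<oplus> T) rs \<zero>"

definition weights :: "real list set" where
  "weights = {rs. rs \<noteq> [] \<and> set rs \<subseteq> Q}"

lemma weightsD: "rs \<in> weights \<Longrightarrow> set rs \<subseteq> Q"
  by (simp add: weights_def)

lemma singleton_weights [simp, intro]: "r \<in> Q \<Longrightarrow> [r] \<in> weights"
  by (simp add: weights_def)

lemma append_weights [intro]: "rs \<in> weights \<Longrightarrow> ss \<in> weights \<Longrightarrow> rs @ ss \<in> weights"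
  by (simp add: weights_def)

lemma weight_pos: "rs \<in> weights \<Longrightarrow> 0 < sum_list rs"
proof (induction rs)
  case (Cons r rs)
  then show ?case
    by (cases "rs = []") (auto simp: weights_def Q_pos intro!: add_pos_pos)
qed (simp add: weights_def)

lemma comb_Nil [simp]: "comb [] A = \<zero>"
  by (simp add: comb_def)

lemma comb_Cons [simp]: "comb (r # rs) A = sc r A \<oplus> comb rs A"
  by (simp add: comb_def)

lemma comb_closed' : "set rs \<subseteq> Q \<Longrightarrow> A \<in> S \<Longrightarrow> comb rs A \<in> S"
  by (induction rs) auto

lemma comb_closed [simp, intro]: "rs \<in> weights \<Longrightarrow> A \<in> S \<Longrightarrow> comb rs A \<in> S"
  by (simp add: comb_closed' weightsD)

lemma comb_zero' : "set rs \<subseteq> Q \<Longrightarrow> comb rs \<zero> = \<zero>"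
  by (induction rs) auto

lemma comb_zero [simp]: "rs \<in> weights \<Longrightarrow> comb rs \<zero> = \<zero>"
  by (simp add: comb_zero' weightsD)

lemma comb_add':
  "set rs \<subseteq> Q \<Longrightarrow> A \<in> S \<Longrightarrow> B \<in> S \<Longrightarrow> comb rs (A \<oplus> B) = comb rs A \<oplus> comb rs B"
proof (induction rs)
  case (Cons r rs)
  then have cl: "sc r A \<in> S" "sc r B \<in> S" "comb rs A \<in> S" "comb rs B \<in> S"
    by (auto simp: comb_closed')
  with Cons have "comb (r # rs) (A \<oplus> B) = (sc r A \<oplus> sc r B) \<oplus> (comb rs A \<oplus> comb rs B)"
    by (simp add: sc_add)
  also have "\<dots> = (sc r A \<oplus> comb rs A) \<oplus> (sc r B \<oplus> comb rs B)"
    using cl by (simp add: add_ac)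
  finally show ?case by simp
qed simp

lemma comb_add:
  "rs \<in> weights \<Longrightarrow> A \<in> S \<Longrightarrow> B \<in> S \<Longrightarrow> comb rs (A \<oplus> B) = comb rs A \<oplus> comb rs B"
  by (simp add: comb_add' weightsD)

lemma comb_append':
  "set rs \<subseteq> Q \<Longrightarrow> set ss \<subseteq> Q \<Longrightarrow> A \<in> S \<Longrightarrow> comb (rs @ ss) A = comb rs A \<oplus> comb ss A"
  by (induction rs) (auto simp: add_assoc comb_closed')

lemma comb_append:
  "rs \<in> weights \<Longrightarrow> ss \<in> weights \<Longrightarrow> A \<in> S \<Longrightarrow> comb (rs @ ss) A = comb rs A \<oplus> comb ss A"
  by (simp add: comb_append' weightsD)

lemma sc_comb:
  "r \<in> Q \<Longrightarrow> set rs \<subseteq> Q \<Longrightarrow> A \<in> S \<Longrightarrow> sc r (comb rs A) = comb (map ((*) r) rs) A"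
  by (induction rs) (auto simp: sc_add sc_mult comb_closed')

lemma sc_comb_commute:
  "r \<in> Q \<Longrightarrow> set rs \<subseteq> Q \<Longrightarrow> A \<in> S \<Longrightarrow> sc r (comb rs A) = comb rs (sc r A)"
proof (induction rs)
  case (Cons s rs)
  then have "sc r (sc s A) = sc s (sc r A)"
    by (simp flip: sc_mult add: mult.commute)
  with Cons show ?case by (simp add: sc_add comb_closed')
qed simp

text \<open>
  The product of formal sums, which corresponds to the composition of their actions.
\<close>

definition times_weights :: "real list \<Rightarrow> real list \<Rightarrow> real list" where
  "times_weights rs ss = concat (map (\<lambda>r. map ((*) r) ss) rs)"

lemma times_weights_closed [intro]:
  "rs \<in> weights \<Longrightarrow> ss \<in> weights \<Longrightarrow> times_weights rs ss \<in> weights"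
  by (auto simp: weights_def times_weights_def)

lemma sum_list_times_weights: "sum_list (times_weights rs ss) = sum_list rs * sum_list ss"
  by (induction rs) (auto simp: times_weights_def sum_list_const_mult distrib_right)

lemma comb_comb:
  assumes "rs \<in> weights" "ss \<in> weights" "A \<in> S"
  shows "comb rs (comb ss A) = comb (times_weights rs ss) A"
proof -
  have "set rs \<subseteq> Q \<Longrightarrow> comb rs (comb ss A) = comb (times_weights rs ss) A"
  proof (induction rs)
    case (Cons r rs)
    have "set (map ((*) r) ss) \<subseteq> Q" "set (times_weights rs ss) \<subseteq> Q"
      using Cons.prems assms by (auto simp: times_weights_def weights_def)
    with Cons assms show ?case
      by (auto simp: times_weights_def sc_comb weightsD comb_append')
  qed (simp add: times_weights_def)
  then show ?thesis using assms by (simp add: weightsD)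
qed

lemma comb_commute:
  assumes "rs \<in> weights" "ss \<in> weights" "A \<in> S"
  shows "comb rs (comb ss A) = comb ss (comb rs A)"
proof -
  have "set rs \<subseteq> Q \<Longrightarrow> comb rs (comb ss A) = comb ss (comb rs A)"
  proof (induction rs)
    case (Cons r rs)
    with assms show ?case
      by (simp add: sc_comb_commute weightsD comb_add' comb_closed')
  qed (use assms in simp)
  then show ?thesis using assms by (simp add: weightsD)
qed

text \<open>
  These are the functionals \<open>A \<mapsto> h (0, A)\<close> of semilinear maps \<open>h\<close> with values in \<open>(-\<infinity>, \<infinity>]\<close>.
\<close>

definition linear_map :: "('a \<Rightarrow> ereal) \<Rightarrow> bool" where
  "linear_map h \<longleftrightarrow>
     h \<zero> = 0 \<and>
     (\<forall>A\<in>S. h A \<noteq> -\<infinity>) \<and>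
     (\<forall>A\<in>S. \<forall>B\<in>S. h (A \<oplus> B) = h A + h B) \<and>
     (\<forall>r\<in>Q. \<forall>A\<in>S. h (sc r A) = ereal r * h A)"

lemma linear_mapD:
  assumes "linear_map h"
  shows linear_map_zero: "h \<zero> = 0"
    and linear_map_not_MInf: "A \<in> S \<Longrightarrow> h A \<noteq> -\<infinity>"
    and linear_map_add: "A \<in> S \<Longrightarrow> B \<in> S \<Longrightarrow> h (A \<oplus> B) = h A + h B"
    and linear_map_sc: "r \<in> Q \<Longrightarrow> A \<in> S \<Longrightarrow> h (sc r A) = ereal r * h A"
  using assms by (simp_all add: linear_map_def)

lemma linear_map_comb:
  assumes h: "linear_map h" and "rs \<in> weights" and A: "A \<in> S"
  shows "h (comb rs A) = ereal (sum_list rs) * h A"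
proof -
  have "set rs \<subseteq> Q \<Longrightarrow> h (comb rs A) = ereal (sum_list rs) * h A"
  proof (induction rs)
    case Nil
    then show ?case using h by (simp add: linear_map_def)
  next
    case (Cons r rs)
    have "0 \<le> sum_list rs" using Cons.prems by (intro sum_list_nonneg) (auto dest: Q_pos less_imp_le)
    then have "ereal r * h A + ereal (sum_list rs) * h A = ereal (r + sum_list rs) * h A"
      using Cons.prems Q_pos[of r] by (simp add: ereal_left_distrib flip: plus_ereal.simps)
    with Cons h A show ?case by (simp add: linear_map_def comb_closed')
  qed
  then show ?thesis using assms by (simp add: weightsD)
qed

end

section \<open>Gauges\<close>

text \<open>
  The relation \<open>R\<close> is the one for which functionals are to be monotone. The function \<open>q\<close> is the lower
  bound for their increments, common to all functionals in the construction.
\<close>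

locale gauge_space = scaled_monoid +
  fixes R :: "'a \<Rightarrow> 'a \<Rightarrow> bool" and q :: "'a \<Rightarrow> real"
  assumes R_closed: "R A B \<Longrightarrow> A \<in> S \<and> B \<in> S"
    and R_add: "R A B \<Longrightarrow> C \<in> S \<Longrightarrow> R (A \<oplus> C) (B \<oplus> C)"
    and R_sc: "R A B \<Longrightarrow> r \<in> Q \<Longrightarrow> R (sc r A) (sc r B)"
begin

text \<open>
  Homogeneity is required for all formal sums of scalars. This is stronger than homogeneity for
  scalings, and necessary for a gauge that has a linear minorant with the same value at \<open>A\<close>. The last
  condition is moderate variation with a bound that is independent of \<open>f\<close>.
\<close>

definition gauge :: "('a \<Rightarrow> ereal) \<Rightarrow> bool" where
  "gauge f \<longleftrightarrow>
     f \<zero> = 0 \<and>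
     (\<forall>A\<in>S. \<forall>B\<in>S. f (A \<oplus> B) \<le> f A + f B) \<and>
     (\<forall>rs\<in>weights. \<forall>A\<in>S. f (comb rs A) = ereal (sum_list rs) * f A) \<and>
     (\<forall>A B. R A B \<longrightarrow> f A \<le> f B) \<and>
     (\<forall>A\<in>S. \<forall>B\<in>S. ereal (q A) + f B \<le> f (A \<oplus> B))"

lemma gauge_sc: "gauge f \<Longrightarrow> r \<in> Q \<Longrightarrow> A \<in> S \<Longrightarrow> f (sc r A) = ereal r * f A"
  unfolding gauge_def by (metis comb_Cons comb_Nil add_zero sc_closed singleton_weights
      sum_list_simps add.right_neutral)

lemma gauge_mono: "gauge f \<Longrightarrow> R A B \<Longrightarrow> f A \<le> f B"
  by (simp add: gauge_def)

lemma gauge_not_MInf: "gauge f \<Longrightarrow> A \<in> S \<Longrightarrow> f A \<noteq> -\<infinity>"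
  unfolding gauge_def by (metis add.right_neutral add_zero zero_closed ereal_infty_less_eq(2) PInfty_neq_ereal(1) MInfty_neq_ereal(1))

lemma gauge_mono_comb:
  assumes f: "gauge f" and R: "R A B" and "rs \<in> weights" and "C \<in> S"
  shows "f (comb rs A \<oplus> C) \<le> f (comb rs B \<oplus> C)"
proof -
  have AB: "A \<in> S" "B \<in> S" using R_closed[OF R] by auto
  have "set rs \<subseteq> Q \<Longrightarrow> C \<in> S \<Longrightarrow> f (comb rs A \<oplus> C) \<le> f (comb rs B \<oplus> C)" for C
  proof (induction rs arbitrary: C)
    case (Cons r rs)
    then have cl: "sc r A \<in> S" "sc r B \<in> S" "comb rs A \<in> S" "comb rs B \<in> S" "C \<in> S"
      using AB by (auto simp: comb_closed')
    have "f (comb (r # rs) A \<oplus> C) = f (sc r A \<oplus> (comb rs A \<oplus> C))"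
      using cl by (simp add: add_assoc)
    also have "\<dots> \<le> f (sc r B \<oplus> (comb rs A \<oplus> C))"
      using f R_add[OF R_sc[OF R, of r], of "comb rs A \<oplus> C"] Cons.prems cl by (simp add: gauge_def)
    also have "\<dots> = f (comb rs A \<oplus> (sc r B \<oplus> C))"
      using cl by (simp add: add_left_comm)
    also have "\<dots> \<le> f (comb rs B \<oplus> (sc r B \<oplus> C))"
      using Cons cl by auto
    also have "\<dots> = f (comb (r # rs) B \<oplus> C)"
      using cl by (simp add: add_ac)
    finally show ?case .
  qed simp
  then show ?thesis using assms by (simp add: weightsD)
qed

text \<open>
  Lower bounds for the increment of \<open>f\<close> in direction \<open>b\<close>, uniform in the base point, add up along
  \<open>r\<^sub>1 b + \<dots> + r\<^sub>k b\<close>: scaling the base point by \<open>1 / r\<close> turns a step \<open>r b\<close> into a step \<open>b\<close>. It is applied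
  to \<open>c = f b\<close> for an additive direction \<open>b\<close>, and to \<open>c = q b\<close>.
\<close>

lemma gauge_increment_comb:
  assumes f: "gauge f" and b: "b \<in> S" and c: "\<And>A. A \<in> S \<Longrightarrow> f A + c \<le> f (A \<oplus> b)"
    and "rs \<in> weights" and "A \<in> S"
  shows "f A + ereal (sum_list rs) * c \<le> f (A \<oplus> comb rs b)"
proof -
  have scaled: "f A + ereal r * c \<le> f (A \<oplus> sc r b)" if r: "r \<in> Q" and A: "A \<in> S" for r A
  proof -
    have pos: "0 < r" using r Q_pos by blast
    let ?A = "sc (inverse r) A"
    have A': "A = sc r ?A"
      using pos r A by (simp flip: sc_mult)
    have "f A + ereal r * c = ereal r * f ?A + ereal r * c"
      by (subst A') (use r A in \<open>simp add: gauge_sc[OF f]\<close>)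
    also have "\<dots> = ereal r * (f ?A + c)"
      using pos by (simp add: ereal_pos_distrib)
    also have "\<dots> \<le> ereal r * f (?A \<oplus> b)"
      using pos r A by (intro ereal_mult_left_mono c) auto
    also have "\<dots> = f (sc r (?A \<oplus> b))"
      using r A b by (simp add: gauge_sc[OF f])
    also have "sc r (?A \<oplus> b) = A \<oplus> sc r b"
      using r A b by (simp add: sc_add flip: A')
    finally show ?thesis .
  qed
  have "set rs \<subseteq> Q \<Longrightarrow> A \<in> S \<Longrightarrow> f A + ereal (sum_list rs) * c \<le> f (A \<oplus> comb rs b)" for A
  proof (induction rs arbitrary: A)
    case (Cons r rs)
    have nn: "0 \<le> sum_list rs" using Cons.prems by (intro sum_list_nonneg) (auto dest: Q_pos less_imp_le)
    have "f A + ereal (sum_list (r # rs)) * c = (f A + ereal r * c) + ereal (sum_list rs) * c"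
      using nn Cons.prems Q_pos[of r]
      by (simp add: ereal_left_distrib add.assoc flip: plus_ereal.simps)
    also have "\<dots> \<le> f (A \<oplus> sc r b) + ereal (sum_list rs) * c"
      using Cons.prems by (intro add_right_mono scaled) auto
    also have "\<dots> \<le> f ((A \<oplus> sc r b) \<oplus> comb rs b)"
      using Cons b by auto
    also have "\<dots> = f (A \<oplus> comb (r # rs) b)"
      using Cons.prems b by (simp add: add_assoc comb_closed')
    finally show ?case .
  qed (simp add: zero_ereal_def[symmetric])
  then show ?thesis using assms by (simp add: weightsD)
qed

text \<open>
  Only one inequality is stated; for gauges the other one is subadditivity. The condition concerns
  all base points, which is what makes it survive tilting.
\<close>

definition additive_elements :: "('a \<Rightarrow> ereal) \<Rightarrow> 'a set" where
  "additive_elements f = {b \<in> S. \<forall>A\<in>S. f A + f b \<le> f (A \<oplus> b)}"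

section \<open>Tilting a gauge in one direction\<close>

text \<open>
  The formula is used for finite \<open>f a\<close>, where \<open>real_of_ereal\<close> loses nothing. Outside \<open>S\<close> the value of
  \<open>f\<close> is kept, so that tilts compare pointwise on the whole type; this makes the order used for
  Zorn's lemma antisymmetric.
\<close>

definition tilt :: "('a \<Rightarrow> ereal) \<Rightarrow> 'a \<Rightarrow> 'a \<Rightarrow> ereal" where
  "tilt f a A =
     (if A \<in> S then
        Inf {ereal (inverse (sum_list rs)) *
               (f (comb rs A \<oplus> comb ss a) - ereal (sum_list ss * real_of_ereal (f a))) | rs ss.
             rs \<in> weights \<and> ss \<in> weights}
      else f A)"

text \<open>
  The universal property of the infimum, with denominators cleared. Most facts on tilts are derived
  from it and from \<open>tilt_below\<close>.
\<close>

lemma le_tilt_iff: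
  assumes "A \<in> S"
  shows "x \<le> tilt f a A \<longleftrightarrow>
    (\<forall>rs\<in>weights. \<forall>ss\<in>weights.
       ereal (sum_list rs) * x + ereal (sum_list ss * real_of_ereal (f a)) \<le>
       f (comb rs A \<oplus> comb ss a))"
proof -
  have "x \<le> tilt f a A \<longleftrightarrow>
    (\<forall>rs\<in>weights. \<forall>ss\<in>weights. x \<le> ereal (inverse (sum_list rs)) *
      (f (comb rs A \<oplus> comb ss a) - ereal (sum_list ss * real_of_ereal (f a))))"
    using assms by (auto simp: tilt_def le_Inf_iff)
  then show ?thesis by (simp add: ereal_le_affine_iff weight_pos)
qed

lemma tilt_below:
  assumes "A \<in> S" "rs \<in> weights" "ss \<in> weights"
  shows "ereal (sum_list rs) * tilt f a A + ereal (sum_list ss * real_of_ereal (f a)) \<le>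
       f (comb rs A \<oplus> comb ss a)"
  using le_tilt_iff[OF assms(1), of "tilt f a A" f a] assms by simp

lemma gauge_tilt_le:
  assumes f: "gauge f" and a: "a \<in> S" "f a \<noteq> \<infinity>"
  shows "tilt f a A \<le> f A"
proof (cases "A \<in> S")
  case True
  obtain \<alpha> where \<alpha>: "f a = ereal \<alpha>"
    using a gauge_not_MInf[OF f] by (metis ereal_cases)
  have "tilt f a A + ereal \<alpha> \<le> f (A \<oplus> a)"
    using tilt_below[OF True, of "[1]" "[1]" f a] True a \<alpha> by (simp flip: one_ereal_def)
  also have "\<dots> \<le> f A + ereal \<alpha>"
    using f True a \<alpha> unfolding gauge_def by metis
  finally show ?thesis
    by (cases "tilt f a A"; cases "f A") auto
qed (simp add: tilt_def)

text \<open>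
  Moving \<open>a\<close> from the argument into the second formal sum, \<open>ss\<close> becomes \<open>rs @ ss\<close>. So the family over
  which the infimum at \<open>A \<oplus> a\<close> is taken is, up to the constant \<open>f a\<close>, part of the one at \<open>A\<close>.
\<close>

lemma tilt_self_le:
  assumes f: "gauge f" and a: "a \<in> S" "f a \<noteq> \<infinity>" and A: "A \<in> S"
  shows "tilt f a A + f a \<le> tilt f a (A \<oplus> a)"
proof -
  obtain \<alpha> where \<alpha>: "f a = ereal \<alpha>"
    using a gauge_not_MInf[OF f] by (metis ereal_cases)
  show ?thesis
    unfolding le_tilt_iff[OF add_closed[OF A a(1)]]
  proof (intro ballI)
    fix rs ss assume w: "rs \<in> weights" "ss \<in> weights"
    have "ereal (sum_list rs) * (tilt f a A + f a) + ereal (sum_list ss * real_of_ereal (f a)) =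
      ereal (sum_list rs) * tilt f a A + ereal (sum_list (rs @ ss) * real_of_ereal (f a))"
      using weight_pos[OF w(1)] \<alpha> by (cases "tilt f a A") (auto simp: algebra_simps)
    also have "\<dots> \<le> f (comb rs A \<oplus> comb (rs @ ss) a)"
      using w A by (intro tilt_below) auto
    also have "comb rs A \<oplus> comb (rs @ ss) a = comb rs (A \<oplus> a) \<oplus> comb ss a"
      using w A a by (simp add: comb_append comb_add add_assoc)
    finally show "ereal (sum_list rs) * (tilt f a A + f a) +
        ereal (sum_list ss * real_of_ereal (f a)) \<le> f (comb rs (A \<oplus> a) \<oplus> comb ss a)" .
  qed
qed

text \<open>
  Tilting preserves every lower bound for the increment in a direction \<open>b\<close>. Both the bound by \<open>q\<close> and
  the additive directions of \<open>f\<close> pass to the tilt for this reason.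
\<close>

lemma tilt_increment:
  assumes f: "gauge f" and a: "a \<in> S" and b: "b \<in> S"
    and c: "\<And>A. A \<in> S \<Longrightarrow> f A + c \<le> f (A \<oplus> b)" and A: "A \<in> S"
  shows "tilt f a A + c \<le> tilt f a (A \<oplus> b)"
  unfolding le_tilt_iff[OF add_closed[OF A b]]
proof (intro ballI)
  fix rs ss assume w: "rs \<in> weights" "ss \<in> weights"
  have "ereal (sum_list rs) * (tilt f a A + c) + ereal (sum_list ss * real_of_ereal (f a)) =
    (ereal (sum_list rs) * tilt f a A + ereal (sum_list ss * real_of_ereal (f a))) + ereal (sum_list rs) * c"
    using weight_pos[OF w(1)] by (cases "tilt f a A"; cases c) (auto simp: algebra_simps)
  also have "\<dots> \<le> f (comb rs A \<oplus> comb ss a) + ereal (sum_list rs) * c"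
    using w A by (intro add_right_mono tilt_below) auto
  also have "\<dots> \<le> f ((comb rs A \<oplus> comb ss a) \<oplus> comb rs b)"
    using w A a by (intro gauge_increment_comb[OF f b c]) auto
  also have "(comb rs A \<oplus> comb ss a) \<oplus> comb rs b = comb rs (A \<oplus> b) \<oplus> comb ss a"
    using w A a b by (simp add: comb_add add_ac)
  finally show "ereal (sum_list rs) * (tilt f a A + c) +
      ereal (sum_list ss * real_of_ereal (f a)) \<le> f (comb rs (A \<oplus> b) \<oplus> comb ss a)" .
qed

lemma tilt_zero:
  assumes f: "gauge f" and a: "a \<in> S" "f a \<noteq> \<infinity>"
  shows "tilt f a \<zero> = 0"
proof (rule antisym)
  show "tilt f a \<zero> \<le> 0"
    using gauge_tilt_le[OF f a, of \<zero>] f by (simp add: gauge_def)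
  obtain \<alpha> where \<alpha>: "f a = ereal \<alpha>"
    using a gauge_not_MInf[OF f] by (metis ereal_cases)
  show "0 \<le> tilt f a \<zero>"
    using f \<alpha> a by (auto simp: le_tilt_iff gauge_def)
qed

lemma tilt_lower_bound:
  assumes f: "gauge f" and a: "a \<in> S" "f a \<noteq> \<infinity>" and A: "A \<in> S" "B \<in> S"
  shows "ereal (q A) + tilt f a B \<le> tilt f a (A \<oplus> B)"
proof -
  have "f B + ereal (q A) \<le> f (B \<oplus> A)" if "B \<in> S" for B
    using f A that by (simp add: gauge_def add.commute add_comm)
  from tilt_increment[OF f a(1) A(1) this A(2)] show ?thesis
    using A by (simp add: add.commute add_comm)
qed

lemma tilt_not_MInf:
  assumes f: "gauge f" and a: "a \<in> S" "f a \<noteq> \<infinity>" and A: "A \<in> S"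
  shows "tilt f a A \<noteq> -\<infinity>"
  using tilt_lower_bound[OF f a A zero_closed] tilt_zero[OF f a] A by auto

lemma tilt_comb_ge:
  assumes "A \<in> S" and w: "rs \<in> weights"
  shows "ereal (sum_list rs) * tilt f a A \<le> tilt f a (comb rs A)"
  unfolding le_tilt_iff[OF comb_closed[OF w assms(1)]]
proof (intro ballI)
  fix rs' ss assume w': "rs' \<in> weights" "ss \<in> weights"
  have "ereal (sum_list rs') * (ereal (sum_list rs) * tilt f a A) =
    ereal (sum_list (times_weights rs' rs)) * tilt f a A"
    by (simp add: sum_list_times_weights mult.assoc flip: times_ereal.simps(1))
  then show "ereal (sum_list rs') * (ereal (sum_list rs) * tilt f a A) +
      ereal (sum_list ss * real_of_ereal (f a)) \<le> f (comb rs' (comb rs A) \<oplus> comb ss a)"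
    using w w' assms tilt_below[of A "times_weights rs' rs" ss f a]
    by (simp add: comb_comb times_weights_closed)
qed

lemma tilt_comb:
  assumes f: "gauge f" and a: "a \<in> S" "f a \<noteq> \<infinity>" and A: "A \<in> S" and w: "rs \<in> weights"
  shows "tilt f a (comb rs A) = ereal (sum_list rs) * tilt f a A"
proof (rule antisym)
  obtain \<alpha> where \<alpha>: "f a = ereal \<alpha>"
    using a gauge_not_MInf[OF f] by (metis ereal_cases)
  let ?n = "sum_list rs"
  have pos: "0 < ?n" by (rule weight_pos[OF w])
  have "ereal (inverse ?n) * tilt f a (comb rs A) \<le> tilt f a A"
    unfolding le_tilt_iff[OF A]
  proof (intro ballI)
    fix rs' ss assume w': "rs' \<in> weights" "ss \<in> weights"
    \<comment> \<open>Apply \<open>rs\<close> to the whole argument of \<open>f\<close>: since formal sums commute, \<open>rs\<close> moves next to \<open>A\<close>.\<close>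
    have "ereal ?n * (ereal (sum_list rs') * (ereal (inverse ?n) * tilt f a (comb rs A)) +
        ereal (sum_list ss * real_of_ereal (f a))) =
      ereal (sum_list rs') * tilt f a (comb rs A) +
        ereal (sum_list (times_weights rs ss) * real_of_ereal (f a))"
      using pos weight_pos[OF w'(1)]
      by (cases "tilt f a (comb rs A)") (auto simp: sum_list_times_weights algebra_simps)
    also have "\<dots> \<le> f (comb rs' (comb rs A) \<oplus> comb (times_weights rs ss) a)"
      using w w' A by (intro tilt_below) auto
    also have "comb rs' (comb rs A) \<oplus> comb (times_weights rs ss) a =
        comb rs (comb rs' A \<oplus> comb ss a)"
      using w w' A a by (simp add: comb_comb[symmetric] comb_add comb_commute[of rs'])
    also have "f \<dots> = ereal ?n * f (comb rs' A \<oplus> comb ss a)"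
      using f w w' A a by (simp add: gauge_def)
    finally show "ereal (sum_list rs') * (ereal (inverse ?n) * tilt f a (comb rs A)) +
        ereal (sum_list ss * real_of_ereal (f a)) \<le> f (comb rs' A \<oplus> comb ss a)"
      using pos by (simp add: ereal_mult_le_mult_iff_pos)
  qed
  then show "tilt f a (comb rs A) \<le> ereal ?n * tilt f a A"
    using pos by (cases "tilt f a A"; cases "tilt f a (comb rs A)") (auto simp: field_simps)
qed (use tilt_comb_ge A w in simp)

lemma tilt_subadditive:
  assumes f: "gauge f" and a: "a \<in> S" "f a \<noteq> \<infinity>" and AB: "A \<in> S" "B \<in> S"
  shows "tilt f a (A \<oplus> B) \<le> tilt f a A + tilt f a B"
proof -
  obtain \<alpha> where \<alpha>: "f a = ereal \<alpha>"
    using a gauge_not_MInf[OF f] by (metis ereal_cases)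
  let ?T = "\<lambda>A rs ss. ereal (inverse (sum_list rs)) *
    (f (comb rs A \<oplus> comb ss a) - ereal (sum_list ss * real_of_ereal (f a)))"
  let ?V = "\<lambda>A. {?T A rs ss | rs ss. rs \<in> weights \<and> ss \<in> weights}"
  have eq: "tilt f a A = Inf (?V A)" "tilt f a B = Inf (?V B)"
    using AB by (simp_all add: tilt_def)
  have "tilt f a (A \<oplus> B) \<le> Inf (?V A) + Inf (?V B)"
  proof (rule le_Inf_plus_Inf)
    fix v w assume "v \<in> ?V A" "w \<in> ?V B"
    then obtain rs ss rs' ss' where v: "v = ?T A rs ss" and w: "w = ?T B rs' ss'"
      and ws: "rs \<in> weights" "ss \<in> weights" "rs' \<in> weights" "ss' \<in> weights" by blast
    let ?F = "f (comb rs A \<oplus> comb ss a)" and ?F' = "f (comb rs' B \<oplus> comb ss' a)"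
    let ?t = "times_weights rs' ss @ times_weights rs ss'"
    have pos: "0 < sum_list rs" "0 < sum_list rs'" using ws weight_pos by auto
    have cl: "comb rs A \<oplus> comb ss a \<in> S" "comb rs' B \<oplus> comb ss' a \<in> S"
      using ws AB a by auto
    \<comment> \<open>Common denominator: \<open>rs'\<close> is applied to the term for \<open>A\<close>, \<open>rs\<close> to the term for \<open>B\<close>.\<close>
    have "comb (times_weights rs rs') (A \<oplus> B) \<oplus> comb ?t a =
      comb rs' (comb rs A \<oplus> comb ss a) \<oplus> comb rs (comb rs' B \<oplus> comb ss' a)"
      using ws AB a
      by (simp add: comb_append times_weights_closed comb_comb[symmetric] comb_add
          comb_commute[of rs rs'] add_ac)
    moreover have "ereal (sum_list (times_weights rs rs')) * tilt f a (A \<oplus> B) +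
        ereal (sum_list ?t * real_of_ereal (f a)) \<le> f (comb (times_weights rs rs') (A \<oplus> B) \<oplus> comb ?t a)"
      using ws AB by (intro tilt_below) auto
    moreover have "f (comb rs' (comb rs A \<oplus> comb ss a) \<oplus> comb rs (comb rs' B \<oplus> comb ss' a)) \<le>
        ereal (sum_list rs') * ?F + ereal (sum_list rs) * ?F'"
      using f cl ws unfolding gauge_def by (metis comb_closed)
    ultimately have "ereal (sum_list rs * sum_list rs') * tilt f a (A \<oplus> B) +
        ereal ((sum_list rs' * sum_list ss + sum_list rs * sum_list ss') * \<alpha>) \<le>
        ereal (sum_list rs') * ?F + ereal (sum_list rs) * ?F'"
      using \<alpha> by (simp add: sum_list_times_weights)
    moreover have "?F \<noteq> -\<infinity>" "?F' \<noteq> -\<infinity>"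
      using cl gauge_not_MInf[OF f] by auto
    ultimately show "tilt f a (A \<oplus> B) \<le> v + w"
      unfolding v w using pos \<alpha>
      by (cases ?F; cases ?F'; cases "tilt f a (A \<oplus> B)") (auto simp: field_simps)
  qed (use tilt_not_MInf[OF f a AB(1)] tilt_not_MInf[OF f a AB(2)] eq in auto)
  then show ?thesis using eq by simp
qed

lemma gauge_tilt:
  assumes f: "gauge f" and a: "a \<in> S" "f a \<noteq> \<infinity>"
  shows "gauge (tilt f a)"
proof -
  have "tilt f a A \<le> tilt f a B" if R: "R A B" for A B
  proof -
    have AB: "A \<in> S" "B \<in> S" using R_closed[OF R] by auto
    show ?thesis
      unfolding le_tilt_iff[OF AB(2)]
    proof (intro ballI)
      fix rs ss assume w: "rs \<in> weights" "ss \<in> weights"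
      show "ereal (sum_list rs) * tilt f a A + ereal (sum_list ss * real_of_ereal (f a)) \<le>
          f (comb rs B \<oplus> comb ss a)"
        using tilt_below[OF AB(1) w] gauge_mono_comb[OF f R w(1) comb_closed[OF w(2) a(1)]]
        by (rule order_trans)
    qed
  qed
  then show ?thesis
    using tilt_zero[OF f a] tilt_subadditive[OF f a] tilt_comb[OF f a] tilt_lower_bound[OF f a]
    unfolding gauge_def by blast
qed

lemma tilt_additive_elements:
  assumes f: "gauge f" and a: "a \<in> S" "f a \<noteq> \<infinity>" and b: "b \<in> additive_elements f"
  shows "b \<in> additive_elements (tilt f a) \<and> tilt f a b = f b"
proof -
  have bS: "b \<in> S" and c: "\<And>A. A \<in> S \<Longrightarrow> f A + f b \<le> f (A \<oplus> b)"
    using b by (auto simp: additive_elements_def)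
  note inc = tilt_increment[OF f a(1) bS c]
  have "f b \<le> tilt f a b"
    using inc[OF _ zero_closed] tilt_zero[OF f a] bS by simp
  then have "tilt f a b = f b"
    using gauge_tilt_le[OF f a, of b] by simp
  then show ?thesis using inc bS by (auto simp: additive_elements_def)
qed

lemma tilt_self:
  assumes f: "gauge f" and a: "a \<in> S" "f a \<noteq> \<infinity>"
  shows "a \<in> additive_elements (tilt f a) \<and> tilt f a a = f a"
proof -
  note inc = tilt_self_le[OF f a]
  have "f a \<le> tilt f a a"
    using inc[OF zero_closed] tilt_zero[OF f a] a by simp
  then have "tilt f a a = f a"
    using gauge_tilt_le[OF f a, of a] by simp
  then show ?thesis using inc a by (auto simp: additive_elements_def)
qed

lemma infinite_additive_element:
  assumes f: "gauge f" and a: "a \<in> S" "f a = \<infinity>"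
  shows "a \<in> additive_elements f"
proof -
  have "f (A \<oplus> a) = \<infinity>" if "A \<in> S" for A
    using f a that unfolding gauge_def
    by (metis PInfty_neq_ereal(1) ereal_infty_less_eq(1) plus_ereal.simps(2,3))
  then show ?thesis using a by (simp add: additive_elements_def)
qed

text \<open>
  This is the reason for \<open>W\<close>-maximality: a competitor that reaches \<open>f a\<close> at \<open>a\<close> is not cut off by
  the tilt in direction \<open>a\<close>.
\<close>

lemma linear_le_tilt:
  assumes f: "gauge f" and a: "a \<in> S" "f a \<noteq> \<infinity>" and h: "linear_map h"
    and le: "\<And>A. A \<in> S \<Longrightarrow> h A \<le> f A" and ha: "f a \<le> h a" and A: "A \<in> S"
  shows "h A \<le> tilt f a A"
  unfolding le_tilt_iff[OF A]
proof (intro ballI)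
  fix rs ss assume w: "rs \<in> weights" "ss \<in> weights"
  have eq: "h a = f a" using le[OF a(1)] ha by simp
  obtain \<alpha> where \<alpha>: "f a = ereal \<alpha>"
    using a gauge_not_MInf[OF f] by (metis ereal_cases)
  have "ereal (sum_list rs) * h A + ereal (sum_list ss * real_of_ereal (f a)) =
      h (comb rs A) + h (comb ss a)"
    using w A a \<alpha> eq by (simp add: linear_map_comb[OF h])
  also have "\<dots> = h (comb rs A \<oplus> comb ss a)"
    using h w A a by (simp add: linear_map_def)
  also have "\<dots> \<le> f (comb rs A \<oplus> comb ss a)"
    using w A a by (intro le) auto
  finally show "ereal (sum_list rs) * h A + ereal (sum_list ss * real_of_ereal (f a)) \<le>
      f (comb rs A \<oplus> comb ss a)" .
qed

section \<open>Maximal linear minorants\<close>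

text \<open>
  The order for Zorn's lemma. That additive directions persist with their values is part of the
  order, because it does not follow from \<open>u \<le> f\<close>.
\<close>

definition tightens :: "('a \<Rightarrow> ereal) \<Rightarrow> ('a \<Rightarrow> ereal) \<Rightarrow> bool" where
  "tightens f u \<longleftrightarrow> u \<le> f \<and> (\<forall>b\<in>additive_elements f. b \<in> additive_elements u \<and> u b = f b)"

lemma tightens_refl: "tightens f f"
  by (simp add: tightens_def)

lemma tightens_trans: "tightens f u \<Longrightarrow> tightens u w \<Longrightarrow> tightens f w"
  by (auto simp: tightens_def intro: order_trans)

lemma tightens_antisym: "tightens f u \<Longrightarrow> tightens u f \<Longrightarrow> f = u"
  unfolding tightens_def by (blast intro: antisym)

text \<open>
  Of two members of a chain one is pointwise smaller, so in the infimum of the sums \<open>f A + f' B\<close> both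
  summands may come from the same \<open>f\<close>; this gives subadditivity. If \<open>b\<close> is an additive direction of \<open>f\<close>,
  all members that tighten \<open>f\<close> share the value \<open>f b\<close>, and the inequality \<open>f' A + f b \<le> f' (A \<oplus> b)\<close> passes to
  the infimum over \<open>f'\<close>.
\<close>

lemma tightens_chain_Inf:
  assumes ne: "C \<noteq> {}" and g: "\<And>f. f \<in> C \<Longrightarrow> gauge f"
    and chain: "\<And>f f'. f \<in> C \<Longrightarrow> f' \<in> C \<Longrightarrow> tightens f f' \<or> tightens f' f"
  defines "u \<equiv> \<lambda>A. INF f\<in>C. f A"
  shows "gauge u" and "f \<in> C \<Longrightarrow> tightens f u"
proof -
  have le: "u A \<le> f A" if "f \<in> C" for f A
    unfolding u_def using that by (rule INF_lower)
  have ge: "x \<le> u A" if "\<And>f. f \<in> C \<Longrightarrow> x \<le> f A" for x A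
    using that by (simp add: u_def INF_greatest)
  have zero: "u \<zero> = 0"
  proof (rule antisym)
    from ne obtain f where "f \<in> C" by blast
    then show "u \<zero> \<le> 0" using le[of f \<zero>] g[of f] by (simp add: gauge_def)
    show "0 \<le> u \<zero>"
    proof (rule ge)
      fix f assume "f \<in> C"
      then show "0 \<le> f \<zero>" using g[of f] by (simp add: gauge_def)
    qed
  qed
  have low: "ereal (q A) + u B \<le> u (A \<oplus> B)" if "A \<in> S" "B \<in> S" for A B
  proof (rule ge)
    fix f assume f: "f \<in> C"
    have "ereal (q A) + u B \<le> ereal (q A) + f B"
      using le[OF f] by (intro add_left_mono)
    also have "\<dots> \<le> f (A \<oplus> B)"
      using g[OF f] that by (simp add: gauge_def)
    finally show "ereal (q A) + u B \<le> f (A \<oplus> B)" .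
  qed
  have fin: "u A \<noteq> -\<infinity>" if "A \<in> S" for A
    using low[OF that zero_closed] zero that by auto
  have "u (A \<oplus> B) \<le> u A + u B" if AB: "A \<in> S" "B \<in> S" for A B
  proof -
    have "u (A \<oplus> B) \<le> Inf ((\<lambda>f. f A) ` C) + Inf ((\<lambda>f. f B) ` C)"
    proof (rule le_Inf_plus_Inf)
      fix v w assume "v \<in> (\<lambda>f. f A) ` C" "w \<in> (\<lambda>f. f B) ` C"
      then obtain f f' where f: "f \<in> C" "f' \<in> C" "v = f A" "w = f' B" by blast
      from chain[OF f(1,2)] obtain f'' where f'': "f'' \<in> C" "f'' \<le> f" "f'' \<le> f'"
        using f unfolding tightens_def by blast
      have "u (A \<oplus> B) \<le> f'' (A \<oplus> B)" by (rule le[OF f''(1)])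
      also have "\<dots> \<le> f'' A + f'' B"
        using g[OF f''(1)] AB by (simp add: gauge_def)
      also have "\<dots> \<le> v + w"
        using f f'' by (intro add_mono) (auto simp: le_fun_def)
      finally show "u (A \<oplus> B) \<le> v + w" .
    qed (use fin AB in \<open>auto simp: u_def\<close>)
    then show ?thesis by (simp add: u_def)
  qed
  moreover have "u (comb rs A) = ereal (sum_list rs) * u A" if w: "rs \<in> weights" and A: "A \<in> S" for rs A
  proof (rule antisym)
    let ?n = "sum_list rs"
    have pos: "0 < ?n" by (rule weight_pos[OF w])
    have comb: "f (comb rs A) = ereal ?n * f A" if "f \<in> C" for f
      using g[OF that] w A by (simp add: gauge_def)
    show "ereal ?n * u A \<le> u (comb rs A)"
    proof (rule ge)
      fix f assume f: "f \<in> C"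
      show "ereal ?n * u A \<le> f (comb rs A)"
        unfolding comb[OF f] using pos le[OF f] by (simp add: ereal_mult_le_mult_iff_pos)
    qed
    have "ereal (inverse ?n) * u (comb rs A) \<le> u A"
    proof (rule ge)
      fix f assume f: "f \<in> C"
      have "ereal (inverse ?n) * u (comb rs A) \<le> ereal (inverse ?n) * (ereal ?n * f A)"
        using pos le[OF f, of "comb rs A"] comb[OF f] by (simp add: ereal_mult_le_mult_iff_pos)
      also have "\<dots> = f A"
        using pos by (simp add: mult.assoc[symmetric] flip: one_ereal_def)
      finally show "ereal (inverse ?n) * u (comb rs A) \<le> f A" .
    qed
    then show "u (comb rs A) \<le> ereal ?n * u A"
      using pos by (cases "u A"; cases "u (comb rs A)") (auto simp: field_simps)
  qed
  moreover have "u A \<le> u B" if "R A B" for A B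
  proof (rule ge)
    fix f assume f: "f \<in> C"
    show "u A \<le> f B" using le[OF f, of A] g[OF f] that by (auto simp: gauge_def intro: order_trans)
  qed
  ultimately show "gauge u"
    using zero low by (simp add: gauge_def)
  assume f: "f \<in> C"
  have "b \<in> additive_elements u \<and> u b = f b" if b: "b \<in> additive_elements f" for b
  proof -
    have bS: "b \<in> S" using b by (simp add: additive_elements_def)
    have ub: "u b = f b"
    proof (rule antisym[OF le[OF f]], rule ge)
      fix f' assume "f' \<in> C"
      with chain[OF f this] b show "f b \<le> f' b" by (auto simp: tightens_def le_fun_def)
    qed
    moreover have "u A + u b \<le> u (A \<oplus> b)" if A: "A \<in> S" for A
    proof (rule ge)
      fix f' assume f': "f' \<in> C"
      from chain[OF f f'] show "u A + u b \<le> f' (A \<oplus> b)"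
      proof
        assume "tightens f f'"
        then have "b \<in> additive_elements f'" "f' b = f b" using b by (auto simp: tightens_def)
        then have "f' A + u b \<le> f' (A \<oplus> b)" using A ub by (simp add: additive_elements_def)
        then show ?thesis using add_right_mono[OF le[OF f', of A], of "u b"] by (rule order_trans[rotated])
      next
        assume t: "tightens f' f"
        have "u A + u b \<le> f A + f b" using le[OF f] by (intro add_mono)
        also have "\<dots> \<le> f (A \<oplus> b)" using b A by (simp add: additive_elements_def)
        also have "\<dots> \<le> f' (A \<oplus> b)" using t by (simp add: tightens_def le_fun_def)
        finally show ?thesis .
      qed
    qed
    ultimately show ?thesis using bS by (simp add: additive_elements_def)
  qed
  then show "tightens f u" using le[OF f] by (simp add: tightens_def le_fun_def)
qed

lemma tightens_tilt:
  assumes "gauge f" "a \<in> S" "f a \<noteq> \<infinity>"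
  shows "tightens f (tilt f a)"
  using gauge_tilt_le[OF assms] tilt_additive_elements[OF assms]
  by (simp add: tightens_def le_fun_def)

text \<open>
  The last property says that a linear map below \<open>f0\<close> can only exceed \<open>f\<close> somewhere if it is less
  than \<open>f\<close> somewhere on \<open>W\<close>. Inside the proof it is required on those elements of \<open>W\<close> that are additive
  so far: in this form it holds for \<open>f0\<close>, passes to infima of chains, and survives a tilt in
  the direction of a further element of \<open>W\<close>, because that element joins the premise.
\<close>

lemma extend_additive_elements:
  assumes f0: "gauge f0" and W: "W \<subseteq> S"
  obtains f where "gauge f" "tightens f0 f" "W \<subseteq> additive_elements f"
    and "\<And>h A. linear_map h \<Longrightarrow> (\<And>B. B \<in> S \<Longrightarrow> h B \<le> f0 B) \<Longrightarrow> (\<And>w. w \<in> W \<Longrightarrow> f w \<le> h w) \<Longrightarrow>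
           A \<in> S \<Longrightarrow> h A \<le> f A"
proof -
  define dominated where "dominated f h \<longleftrightarrow> (\<forall>B\<in>S. h B \<le> f B)" for f h :: "'a \<Rightarrow> ereal"
  define G where "G = {f. gauge f \<and> tightens f0 f \<and>
    (\<forall>h. linear_map h \<and> dominated f0 h \<and> (\<forall>w\<in>W \<inter> additive_elements f. f w \<le> h w) \<longrightarrow>
       dominated f h)}"
  have f0G: "f0 \<in> G" using f0 by (simp add: G_def tightens_refl)
  have "\<exists>m\<in>G. \<forall>f\<in>G. tightens m f \<longrightarrow> f = m"
  proof (rule predicate_Zorn)
    show "partial_order_on G (relation_of tightens G)"
      by (rule partial_order_on_relation_ofI) (auto intro: tightens_refl tightens_trans tightens_antisym)
  next
    fix C assume C: "C \<in> Chains (relation_of tightens G)"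
    then have CG: "C \<subseteq> G" and chain: "\<And>f f'. f \<in> C \<Longrightarrow> f' \<in> C \<Longrightarrow> tightens f f' \<or> tightens f' f"
      by (auto simp: Chains_def relation_of_def)
    show "\<exists>u\<in>G. \<forall>f\<in>C. tightens f u"
    proof (cases "C = {}")
      case True
      then show ?thesis using f0G by blast
    next
      case False
      define u where "u = (\<lambda>A. INF f\<in>C. f A)"
      have g: "\<And>f. f \<in> C \<Longrightarrow> gauge f" using CG by (auto simp: G_def)
      have u: "gauge u" and t: "\<And>f. f \<in> C \<Longrightarrow> tightens f u"
        unfolding u_def using tightens_chain_Inf[OF False g chain] by blast+
      have "tightens f0 u"
        using False CG t by (auto simp: G_def intro: tightens_trans)
      moreover have "dominated u h"
        if h: "linear_map h" "dominated f0 h" "\<forall>w\<in>W \<inter> additive_elements u. u w \<le> h w" for h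
      proof -
        have "dominated f h" if f: "f \<in> C" for f
        proof -
          have "\<forall>w\<in>W \<inter> additive_elements f. f w \<le> h w"
            using h(3) t[OF f] unfolding tightens_def by (metis IntD1 IntD2 IntI)
          then show ?thesis using f CG h by (auto simp: G_def)
        qed
        then show ?thesis by (simp add: dominated_def u_def INF_greatest)
      qed
      ultimately have "u \<in> G" using u by (simp add: G_def)
      then show ?thesis using t by blast
    qed
  qed
  then obtain m where m: "m \<in> G" and max: "\<And>f. f \<in> G \<Longrightarrow> tightens m f \<Longrightarrow> f = m" by blast
  have gm: "gauge m" using m by (simp add: G_def)
  have WA: "W \<subseteq> additive_elements m"
  proof
    fix w assume w: "w \<in> W"
    show "w \<in> additive_elements m"
    proof (cases "m w = \<infinity>")
      case True
      then show ?thesis using infinite_additive_element[OF gm] w W by blast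
    next
      case False
      have wS: "w \<in> S" using w W by blast
      let ?t = "tilt m w"
      have t: "tightens m ?t" by (rule tightens_tilt[OF gm wS False])
      have "dominated ?t h"
        if h: "linear_map h" "dominated f0 h" "\<forall>w\<in>W \<inter> additive_elements ?t. ?t w \<le> h w" for h
      proof -
        have "\<forall>w\<in>W \<inter> additive_elements m. m w \<le> h w"
          using h(3) t unfolding tightens_def by (metis IntD1 IntD2 IntI)
        then have "dominated m h" using m h by (auto simp: G_def)
        moreover have "m w \<le> h w"
          using h(3) w tilt_self[OF gm wS False] by (metis IntI)
        ultimately show ?thesis
          using linear_le_tilt[OF gm wS False h(1)] by (simp add: dominated_def)
      qed
      then have "?t \<in> G"
        using m t gauge_tilt[OF gm wS False] by (auto simp: G_def intro: tightens_trans)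
      with max t have "?t = m" by blast
      then show ?thesis using tilt_self[OF gm wS False] by simp
    qed
  qed
  show ?thesis
  proof (rule that[OF gm _ WA])
    show "tightens f0 m" using m by (simp add: G_def)
  next
    fix h A
    assume "linear_map h" "\<And>B. B \<in> S \<Longrightarrow> h B \<le> f0 B" "\<And>w. w \<in> W \<Longrightarrow> m w \<le> h w" "A \<in> S"
    then show "h A \<le> m A" using m by (auto simp: G_def dominated_def)
  qed
qed

text \<open>
  The elements of \<open>W\<close> are made additive before the others. Directions outside \<open>W\<close> must come second,
  since a tilt in such a direction can cut off competitors for the values on \<open>W\<close>.
\<close>

theorem maximal_linear_minorant:
  assumes f0: "gauge f0" and W: "W \<subseteq> S"
  obtains \<phi> where "gauge \<phi>" "linear_map \<phi>" "\<And>A. A \<in> S \<Longrightarrow> \<phi> A \<le> f0 A"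
    and "\<And>b. b \<in> additive_elements f0 \<Longrightarrow> \<phi> b = f0 b"
    and "\<And>h w. linear_map h \<Longrightarrow> (\<And>B. B \<in> S \<Longrightarrow> h B \<le> f0 B) \<Longrightarrow> (\<And>w. w \<in> W \<Longrightarrow> \<phi> w \<le> h w) \<Longrightarrow>
           w \<in> W \<Longrightarrow> h w = \<phi> w"
proof -
  obtain f where f: "gauge f" "tightens f0 f" "W \<subseteq> additive_elements f"
    and dom: "\<And>h A. linear_map h \<Longrightarrow> (\<And>B. B \<in> S \<Longrightarrow> h B \<le> f0 B) \<Longrightarrow>
        (\<And>w. w \<in> W \<Longrightarrow> f w \<le> h w) \<Longrightarrow> A \<in> S \<Longrightarrow> h A \<le> f A"
    using extend_additive_elements[OF f0 W] by metis
  obtain \<phi> where \<phi>: "gauge \<phi>" "tightens f \<phi>" "S \<subseteq> additive_elements \<phi>"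
    using extend_additive_elements[OF f(1) subset_refl] by metis
  have eqW: "\<phi> w = f w" if "w \<in> W" for w
    using that f(3) \<phi>(2) by (auto simp: tightens_def)
  have "\<phi> (A \<oplus> B) = \<phi> A + \<phi> B" if "A \<in> S" "B \<in> S" for A B
    using that \<phi>(1,3) by (intro antisym) (auto simp: gauge_def additive_elements_def)
  then have "linear_map \<phi>"
    using \<phi>(1) gauge_sc[OF \<phi>(1)] gauge_not_MInf[OF \<phi>(1)] by (simp add: linear_map_def gauge_def)
  moreover have "tightens f0 \<phi>" using f \<phi> tightens_trans by blast
  ultimately show ?thesis
  proof (intro that[OF \<phi>(1)])
    fix h w
    assume h: "linear_map h" "\<And>B. B \<in> S \<Longrightarrow> h B \<le> f0 B" "\<And>w. w \<in> W \<Longrightarrow> \<phi> w \<le> h w" and w: "w \<in> W"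
    have "h w \<le> f w"
      using dom[OF h(1,2), of w] h(3) eqW w W by fastforce
    then show "h w = \<phi> w" using h(3)[OF w] eqW[OF w] by simp
  qed (auto simp: tightens_def le_fun_def)
qed

end

section \<open>Translations in a cancellative space\<close>

locale cancellative_space =
  fixes M :: "'x::topological_ab_group_add qspace" (structure)
  assumes space: "quasisemilinear_preordered_space M"
    and cancellative: "monotonely_cancellative M"
begin

lemma space_conditions:
  shows scalars_cases: "scalars M \<in> {\<rat>, \<real>, UNIV}"
    and pscalars_cases: "pscalars M \<in> {scalars M - {0}, complex_of_real ` posreals M}"
    and vector_space: "topological_vector_space_over (scalars M) (vscale M)"
    and void_cases: "void M \<in> {\<lambda>v. {}, \<lambda>v. {v}}"
    and empty_closed [simp, intro]: "{} \<in> family M"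
    and hadd_closed [rule_format, simp, intro]: "\<forall>A\<in>family M. \<forall>B\<in>family M. A \<boxplus> B \<in> family M"
    and hadd_assoc [rule_format]:
      "\<forall>A\<in>family M. \<forall>B\<in>family M. \<forall>C\<in>family M. (A \<boxplus> B) \<boxplus> C = A \<boxplus> (B \<boxplus> C)"
    and hadd_comm [rule_format]: "\<forall>A\<in>family M. \<forall>B\<in>family M. A \<boxplus> B = B \<boxplus> A"
    and hadd_empty [rule_format, simp]: "\<forall>A\<in>family M. A \<boxplus> {} = A"
    and hle_refl [rule_format, simp, intro]: "\<forall>A\<in>family M. A \<sqsubseteq> A"
    and hle_trans [rule_format]:
      "\<forall>A\<in>family M. \<forall>B\<in>family M. \<forall>C\<in>family M. A \<sqsubseteq> B \<and> B \<sqsubseteq> C \<longrightarrow> A \<sqsubseteq> C"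
    and hle_hadd [rule_format]:
      "\<forall>A1\<in>family M. \<forall>B1\<in>family M. \<forall>A2\<in>family M. \<forall>B2\<in>family M.
         A1 \<sqsubseteq> B1 \<and> A2 \<sqsubseteq> B2 \<longrightarrow> A1 \<boxplus> A2 \<sqsubseteq> B1 \<boxplus> B2"
    and hscale_closed [rule_format]: "\<forall>a\<in>pscalars M. \<forall>A\<in>family M. hscale M a A \<in> family M"
    and hscale_hadd [rule_format]:
      "\<forall>a\<in>pscalars M. \<forall>A\<in>family M. \<forall>B\<in>family M. hscale M a (A \<boxplus> B) = hscale M a A \<boxplus> hscale M a B"
    and hscale_hscale [rule_format]:
      "\<forall>a\<in>pscalars M. \<forall>b\<in>pscalars M. \<forall>A\<in>family M. hscale M (a * b) A = hscale M a (hscale M b A)"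
    and hscale_one [rule_format, simp]: "\<forall>A\<in>family M. hscale M 1 A = A"
    and translate_closed [rule_format, simp, intro]:
      "\<forall>v. \<forall>A\<in>family M. translate M v A \<in> family M"
    and translate_hadd [rule_format]:
      "\<forall>v. \<forall>A\<in>family M. \<forall>B\<in>family M. A \<noteq> {} \<longrightarrow> translate M v (A \<boxplus> B) = translate M v A \<boxplus> B"
    and hscale_mono [rule_format]:
      "\<forall>a\<in>pscalars M. \<forall>A\<in>family M. \<forall>B\<in>family M. A \<sqsubseteq> B \<longrightarrow> hscale M a A \<sqsubseteq> hscale M a B"
    and hle_hadd_zero [rule_format]:
      "\<forall>A\<in>family M. \<forall>B\<in>family M. 0 \<in> B \<longrightarrow> A \<sqsubseteq> A \<boxplus> B"
  using space[unfolded quasisemilinear_preordered_space_def] by - (elim conjE, assumption)+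

lemma posreals_pscalars: "r \<in> posreals M \<Longrightarrow> complex_of_real r \<in> pscalars M"
proof -
  assume r: "r \<in> posreals M"
  then have "complex_of_real r \<in> scalars M - {0}" by (simp add: posreals_def)
  then show "complex_of_real r \<in> pscalars M"
    using pscalars_cases imageI[OF r, of complex_of_real] by (metis insertE empty_iff)
qed

lemma posreals_pos: "r \<in> posreals M \<Longrightarrow> 0 < r"
  by (simp add: posreals_def)

lemma posreals_scalars: "r \<in> posreals M \<Longrightarrow> complex_of_real r \<in> scalars M"
  by (simp add: posreals_def)

lemma real_scalars_closed:
  assumes "complex_of_real r \<in> scalars M" "complex_of_real s \<in> scalars M"
  shows "complex_of_real (r + s) \<in> scalars M" "complex_of_real (r * s) \<in> scalars M"
    "complex_of_real (- r) \<in> scalars M" "complex_of_real (inverse r) \<in> scalars M"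
proof -
  consider "scalars M = \<rat>" | "scalars M = \<real>" | "scalars M = UNIV"
    using scalars_cases by blast
  note K = this
  show "complex_of_real (r + s) \<in> scalars M"
    using K assms by cases simp_all
  show "complex_of_real (r * s) \<in> scalars M"
    using K assms by cases simp_all
  show "complex_of_real (- r) \<in> scalars M"
    using K assms by cases simp_all
  show "complex_of_real (inverse r) \<in> scalars M"
    using K assms by cases simp_all
qed

lemma scalars_zero_one: "0 \<in> scalars M" "1 \<in> scalars M"
proof -
  consider "scalars M = \<rat>" | "scalars M = \<real>" | "scalars M = UNIV"
    using scalars_cases by blast
  note K = this
  show "0 \<in> scalars M" "1 \<in> scalars M"
    using K by (cases; simp)+
qed

lemma vscale_rules:
  shows vscale_right_add [rule_format]:
      "\<forall>a\<in>scalars M. \<forall>x y. vscale M a (x + y) = vscale M a x + vscale M a y"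
    and vscale_left_add [rule_format]:
      "\<forall>a\<in>scalars M. \<forall>b\<in>scalars M. \<forall>x. vscale M (a + b) x = vscale M a x + vscale M b x"
    and vscale_vscale [rule_format]:
      "\<forall>a\<in>scalars M. \<forall>b\<in>scalars M. \<forall>x. vscale M (a * b) x = vscale M a (vscale M b x)"
    and vscale_one [rule_format, simp]: "\<forall>x. vscale M 1 x = x"
  using vector_space[unfolded topological_vector_space_over_def] by - (elim conjE, assumption)+

lemma vscale_zero_right: "a \<in> scalars M \<Longrightarrow> vscale M a 0 = 0"
  using vscale_right_add[of a 0 0] by simp

lemma vscale_zero_left: "vscale M 0 x = 0"
  using vscale_left_add[of 0 0 x] scalars_zero_one by simp

lemma vscale_minus_right: "a \<in> scalars M \<Longrightarrow> vscale M a (- x) = - vscale M a x"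
  using vscale_right_add[of a x "- x"] vscale_zero_right[of a] by (simp add: eq_neg_iff_add_eq_0 add.commute)

lemma hscale_empty [simp]: "hscale M a {} = {}"
  by (simp add: hscale_def)

sublocale scaled_monoid "family M" "hadd M" "{}" "posreals M" "\<lambda>r. hscale M (complex_of_real r)"
proof
  show "1 \<in> posreals M" using scalars_zero_one by (simp add: posreals_def)
  show "r * s \<in> posreals M" if "r \<in> posreals M" "s \<in> posreals M" for r s
    using that real_scalars_closed(2)[of r s] by (simp add: posreals_def)
  show "inverse r \<in> posreals M" if "r \<in> posreals M" for r
    using that real_scalars_closed(4)[of r r] by (simp add: posreals_def)
  show "A \<boxplus> B = B \<boxplus> A" if "A \<in> family M" "B \<in> family M" for A B
    using that by (rule hadd_comm)
qed (simp_all add: hadd_assoc posreals_pos hscale_closed hscale_hadd hscale_hscale posreals_pscalars)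

lemma posreals_add: "r \<in> posreals M \<Longrightarrow> s \<in> posreals M \<Longrightarrow> r + s \<in> posreals M"
  using real_scalars_closed(1)[of r s] by (simp add: posreals_def)

lemma weight_posreals: "rs \<in> weights \<Longrightarrow> sum_list rs \<in> posreals M"
proof (induction rs)
  case (Cons r rs)
  then show ?case
    by (cases "rs = []") (simp_all add: weights_def posreals_add)
qed (simp add: weights_def)

lemma hle_cancel:
  assumes "A \<in> family M" "B \<in> family M" "C \<in> family M"
  shows "A \<boxplus> C \<sqsubseteq> B \<boxplus> C \<longleftrightarrow> A \<sqsubseteq> B"
proof
  show "A \<boxplus> C \<sqsubseteq> B \<boxplus> C \<Longrightarrow> A \<sqsubseteq> B"
    using cancellative[unfolded monotonely_cancellative_def] assms by meson
  show "A \<sqsubseteq> B \<Longrightarrow> A \<boxplus> C \<sqsubseteq> B \<boxplus> C"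
    using assms by (intro hle_hadd conjI hle_refl)
qed

lemma translate_eq_empty: "translate M v A = {} \<Longrightarrow> A = {}"
  by (auto simp: translate_def split: if_splits)

lemma translate_zero: "A \<noteq> {} \<Longrightarrow> translate M 0 A = A"
  by (simp add: translate_def)

lemma translate_translate: "translate M u (translate M v A) = translate M (u + v) A"
proof -
  consider "void M = (\<lambda>v. {})" | "void M = (\<lambda>v. {v})"
    using void_cases by blast
  then show ?thesis
    by cases (simp_all add: translate_def add.assoc image_image)
qed

lemma hscale_translate:
  assumes "r \<in> posreals M"
  shows "hscale M (complex_of_real r) (translate M v A) =
    translate M (vscale M (complex_of_real r) v) (hscale M (complex_of_real r) A)"
proof -
  consider "void M = (\<lambda>v. {})" | "void M = (\<lambda>v. {v})"
    using void_cases by blast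
  then show ?thesis
    by cases (simp_all add: translate_def hscale_def image_image
        vscale_right_add[OF posreals_scalars[OF assms]])
qed

text \<open>
  This is the condition under which a linear map \<open>\<phi>\<close> on sets induces a semilinear map on points:
  \<open>\<phi> (- x + {})\<close> is the value at \<open>(x, {})\<close>, and the value at \<open>(x, A)\<close> must split into a vector part and a
  set part. The normalization at \<open>0\<close> matters because \<open>0 + {}\<close> may be \<open>{0}\<close> instead of \<open>{}\<close>.
\<close>

definition translation_affine :: "('x set \<Rightarrow> ereal) \<Rightarrow> bool" where
  "translation_affine \<phi> \<longleftrightarrow> \<phi> (translate M 0 {}) = 0 \<and>
     (\<forall>v. \<forall>A\<in>family M. \<phi> (translate M v A) = \<phi> (translate M v {}) + \<phi> A)"

lemma translation_affineD:
  "translation_affine \<phi> \<Longrightarrow> A \<in> family M \<Longrightarrow> \<phi> (translate M v A) = \<phi> (translate M v {}) + \<phi> A"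
  unfolding translation_affine_def by blast

text \<open>
  If \<open>v + {} = {v}\<close>, translation by \<open>v\<close> amounts to adding \<open>{v}\<close>, up to a summand \<open>{0}\<close> on which \<open>\<phi>\<close>
  vanishes.
\<close>

lemma translation_affine_singletons:
  assumes void: "void M = (\<lambda>v. {v})" and \<phi>: "linear_map \<phi>" and zero: "\<phi> (translate M 0 {}) = 0"
  shows "translation_affine \<phi>"
proof -
  let ?o = "translate M 0 {}"
  have o: "?o = {0}" using void by (simp add: translate_def)
  have oS: "?o \<in> family M" by simp
  note add = linear_map_add[OF \<phi>]
  have "\<phi> (translate M v A) = \<phi> (translate M v {}) + \<phi> A" if A: "A \<in> family M" for v A
  proof (cases "A = {}")
    case True
    show ?thesis unfolding True linear_map_zero[OF \<phi>] by simp
  next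
    case False
    have ne: "?o \<noteq> {}" unfolding o by simp
    have "\<phi> (translate M v A) = \<phi> (translate M v A) + \<phi> ?o"
      unfolding zero by simp
    also have "\<dots> = \<phi> (translate M v A \<boxplus> ?o)"
      by (rule add[OF translate_closed[OF A] oS, symmetric])
    also have "translate M v A \<boxplus> ?o = translate M v (A \<boxplus> ?o)"
      by (rule translate_hadd[OF A oS False, symmetric])
    also have "A \<boxplus> ?o = ?o \<boxplus> A"
      by (rule hadd_comm[OF A oS])
    also have "translate M v (?o \<boxplus> A) = translate M v ?o \<boxplus> A"
      by (rule translate_hadd[OF oS A ne])
    also have "translate M v ?o = translate M v {}"
      by (simp add: translate_translate)
    also have "\<phi> (translate M v {} \<boxplus> A) = \<phi> (translate M v {}) + \<phi> A"
      by (rule add[OF translate_closed[OF empty_closed] A])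
    finally show ?thesis .
  qed
  then show ?thesis unfolding translation_affine_def using zero by blast
qed

lemma translation_affine_invariant:
  assumes void: "void M = (\<lambda>v. {})" and \<phi>: "linear_map \<phi>"
    and inv: "\<And>v A. A \<in> family M \<Longrightarrow> \<phi> (translate M v A) = \<phi> A"
  shows "translation_affine \<phi>"
proof -
  show ?thesis
    unfolding translation_affine_def
    by (simp add: inv[OF empty_closed] inv linear_map_zero[OF \<phi>])
qed

text \<open>
  Moving a translation from one nonempty summand to the other does not change a sum. So along
  \<open>A, v + A, 2 v + A, \<dots>\<close> the values of \<open>\<phi>\<close> form an arithmetic progression; being nonnegative, they cannot
  decrease, and \<open>- v\<close> gives the converse.
\<close>

lemma nonneg_translation_invariant:
  assumes void: "void M = (\<lambda>v. {})" and \<phi>: "linear_map \<phi>"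
    and nonneg: "\<And>A. A \<in> family M \<Longrightarrow> 0 \<le> \<phi> A" and A: "A \<in> family M"
  shows "\<phi> (translate M v A) = \<phi> A"
proof (cases "A = {}")
  case True
  then show ?thesis using void by (simp add: translate_def)
next
  case False
  have exchange: "\<phi> (translate M v A) + \<phi> B = \<phi> (translate M v B) + \<phi> A"
    if "A \<in> family M" "B \<in> family M" "A \<noteq> {}" "B \<noteq> {}" for v A B
  proof -
    have "translate M v A \<boxplus> B = translate M v (A \<boxplus> B)"
      by (rule translate_hadd[symmetric]) fact+
    also have "A \<boxplus> B = B \<boxplus> A" by (rule hadd_comm) fact+
    also have "translate M v (B \<boxplus> A) = translate M v B \<boxplus> A"
      by (rule translate_hadd) fact+
    finally have "\<phi> (translate M v A \<boxplus> B) = \<phi> (translate M v B \<boxplus> A)" by simp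
    then show ?thesis using that by (simp add: linear_map_add[OF \<phi>])
  qed
  have le: "\<phi> A \<le> \<phi> (translate M v A)" if A: "A \<in> family M" "A \<noteq> {}" for v A
  proof (cases "\<phi> (translate M v A) = \<infinity>")
    case False
    let ?t = "translate M v"
    have ne: "?t A \<noteq> {}" using A translate_eq_empty by blast
    have "\<phi> (?t (?t A)) + \<phi> A = \<phi> (?t A) + \<phi> (?t A)"
      by (rule exchange[OF translate_closed[OF A(1)] A(1) ne A(2)])
    then have "\<phi> A \<noteq> \<infinity>" using False by auto
    moreover have "0 \<le> \<phi> A" "0 \<le> \<phi> (?t A)" using nonneg A by auto
    ultimately obtain a b where ab: "\<phi> A = ereal a" "\<phi> (?t A) = ereal b"
      using False by (cases "\<phi> A"; cases "\<phi> (?t A)") auto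
    have T: "(?t ^^ n) A \<in> family M \<and> (?t ^^ n) A \<noteq> {} \<and> \<phi> ((?t ^^ n) A) = ereal (a + real n * (b - a))" for n
    proof (induction n)
      case (Suc n)
      then have "\<phi> (?t ((?t ^^ n) A)) + \<phi> A = \<phi> (?t A) + \<phi> ((?t ^^ n) A)"
        using exchange A by blast
      then have "\<phi> (?t ((?t ^^ n) A)) = ereal (a + real (Suc n) * (b - a))"
        using Suc ab by (cases "\<phi> (?t ((?t ^^ n) A))") (auto simp: algebra_simps)
      then show ?case using Suc translate_eq_empty by auto
    qed (use A ab in auto)
    have "a \<le> b"
    proof (rule ccontr)
      assume "\<not> a \<le> b"
      then obtain n where "a < real n * (a - b)"
        using reals_Archimedean3[of "a - b"] by auto
      then have "a + real n * (b - a) < 0" by (simp add: algebra_simps)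
      then show False using T[of n] nonneg[of "(?t ^^ n) A"] by simp
    qed
    then show ?thesis using ab by simp
  qed simp
  have "\<phi> (translate M v A) \<le> \<phi> (translate M (- v) (translate M v A))"
    using le[of "translate M v A" "- v"] A False translate_eq_empty by blast
  also have "\<dots> = \<phi> A" using False by (simp add: translate_translate translate_zero)
  finally show ?thesis using le[OF A False] by (simp add: antisym)
qed

text \<open>
  The values at translates of the empty set are finite because those for \<open>v\<close> and \<open>- v\<close> add up to \<open>0\<close>
  and \<open>-\<infinity>\<close> is excluded.
\<close>

lemma translation_functional:
  assumes \<phi>: "linear_map \<phi>" and aff: "translation_affine \<phi>"
  obtains l where "\<And>v. \<phi> (translate M v {}) = ereal (l v)" "\<And>u v. l (u + v) = l u + l v"
    "\<And>r v. complex_of_real r \<in> scalars M \<Longrightarrow> l (vscale M (of_real r) v) = r * l v"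
proof -
  let ?L = "\<lambda>v. \<phi> (translate M v {})"
  have add: "?L (u + v) = ?L u + ?L v" for u v
    using aff translate_translate[of u v "{}"] translate_closed[of "{}" v]
    unfolding translation_affine_def by (metis empty_closed)
  have zero: "?L 0 = 0" using aff by (simp add: translation_affine_def)
  have nM: "?L v \<noteq> -\<infinity>" for v by (rule linear_map_not_MInf[OF \<phi>]) simp
  define l where "l v = real_of_ereal (?L v)" for v
  have l: "?L v = ereal (l v)" for v
  proof -
    have "?L v + ?L (- v) = 0" using add[of v "- v"] zero by simp
    then show ?thesis using nM[of v] nM[of "- v"] by (cases "?L v") (auto simp: l_def)
  qed
  have l_add: "l (u + v) = l u + l v" for u v
    using add[of u v] by (simp add: l)
  have l_minus: "l (- v) = - l v" for v
    using l_add[of v "- v"] l_add[of 0 0] by simp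
  have l_pos: "l (vscale M (of_real r) v) = r * l v" if r: "r \<in> posreals M" for r v
  proof -
    have "?L (vscale M (of_real r) v) = ereal r * ?L v"
      using linear_map_sc[OF \<phi> r, of "translate M v {}"] hscale_translate[OF r, of v "{}"] by simp
    then show ?thesis by (simp add: l)
  qed
  have "l (vscale M (of_real r) v) = r * l v" if r: "complex_of_real r \<in> scalars M" for r v
  proof (cases r "0::real" rule: linorder_cases)
    case less
    then have "- r \<in> posreals M" using r real_scalars_closed(3)[OF r r] by (simp add: posreals_def)
    moreover have "vscale M (of_real r) v = - vscale M (of_real (- r)) v"
      using vscale_left_add[OF r real_scalars_closed(3)[OF r r], of v] vscale_zero_left
      by (simp add: eq_neg_iff_add_eq_0)
    ultimately show ?thesis using l_pos[of "- r" v] l_minus by simp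
  next
    case equal
    then show ?thesis using vscale_zero_left l_add[of 0 0] by simp
  next
    case greater
    then show ?thesis using l_pos r by (simp add: posreals_def)
  qed
  then show ?thesis using that l l_add by blast
qed

section \<open>Maps on points induced by maps on sets\<close>

definition lift_map :: "('x set \<Rightarrow> ereal) \<Rightarrow> 'x \<times> 'x set \<Rightarrow> ereal" where
  "lift_map \<phi> z = \<phi> (translate M (- fst z) (snd z))"

lemma lift_map_eq:
  assumes "translation_affine \<phi>" "z \<in> points M"
  shows "lift_map \<phi> z = \<phi> (translate M (- fst z) {}) + \<phi> (snd z)"
  unfolding lift_map_def
  by (rule translation_affineD[OF assms(1)]) (use assms(2) in \<open>auto simp: points_def\<close>)

lemma lift_map_padd:
  assumes \<phi>: "linear_map \<phi>" and aff: "translation_affine \<phi>" and z: "z \<in> points M" "w \<in> points M"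
  shows "lift_map \<phi> (padd M z w) = lift_map \<phi> z + lift_map \<phi> w"
proof -
  obtain l where l: "\<And>v. \<phi> (translate M v {}) = ereal (l v)" "\<And>u v. l (u + v) = l u + l v"
    using translation_functional[OF \<phi> aff] by metis
  have zw: "snd z \<in> family M" "snd w \<in> family M" "padd M z w \<in> points M"
    using z by (auto simp: points_def padd_def)
  have "\<phi> (snd z) \<noteq> -\<infinity>" "\<phi> (snd w) \<noteq> -\<infinity>"
    using zw linear_map_not_MInf[OF \<phi>] by blast+
  moreover have "l (- (fst z + fst w)) = l (- fst z) + l (- fst w)"
    using l(2)[of "- fst z" "- fst w"] by simp
  ultimately show ?thesis
    unfolding lift_map_eq[OF aff z(1)] lift_map_eq[OF aff z(2)] lift_map_eq[OF aff zw(3)]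
    using linear_map_add[OF \<phi> zw(1,2)]
    by (cases "\<phi> (snd z)"; cases "\<phi> (snd w)") (simp_all add: l(1) padd_def)
qed

lemma lift_map_comb:
  assumes \<phi>: "linear_map \<phi>" and aff: "translation_affine \<phi>" and A: "A \<in> family M" and w: "rs \<in> weights"
  shows "lift_map \<phi> (vscale M (of_real (sum_list rs)) x, comb rs A) = ereal (sum_list rs) * lift_map \<phi> (x, A)"
proof -
  obtain l where l: "\<And>v. \<phi> (translate M v {}) = ereal (l v)"
    "\<And>r v. complex_of_real r \<in> scalars M \<Longrightarrow> l (vscale M (of_real r) v) = r * l v"
    using translation_functional[OF \<phi> aff] by metis
  have n: "complex_of_real (sum_list rs) \<in> scalars M"
    using weight_posreals[OF w] posreals_scalars by blast
  have "l (- vscale M (of_real (sum_list rs)) x) = sum_list rs * l (- x)"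
    using l(2)[OF n, of "- x"] vscale_minus_right[OF n] by simp
  then show ?thesis
    using A comb_closed[OF w A] linear_map_comb[OF \<phi> w A] weight_pos[OF w]
    by (cases "\<phi> A") (simp_all add: lift_map_eq[OF aff] points_def l(1) algebra_simps)
qed

lemma lift_map_translate: "lift_map \<phi> (v + x, translate M v A) = lift_map \<phi> (x, A)"
  by (simp add: lift_map_def translate_translate)

lemma lift_map_at_zero:
  assumes "translation_affine \<phi>" "A \<in> family M"
  shows "lift_map \<phi> (0, A) = \<phi> A"
proof -
  have "\<phi> (translate M 0 {}) = 0" using assms(1) by (simp add: translation_affine_def)
  then show ?thesis
    using lift_map_eq[OF assms(1), of "(0, A)"] assms(2) by (simp add: points_def)
qed

lemma lift_map_semilinear:
  assumes \<phi>: "linear_map \<phi>" and aff: "translation_affine \<phi>"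
  shows "semilinear_on M (points M) (lift_map \<phi>)"
proof -
  obtain l where l: "\<And>v. \<phi> (translate M v {}) = ereal (l v)" "\<And>u v. l (u + v) = l u + l v"
    "\<And>r v. complex_of_real r \<in> scalars M \<Longrightarrow> l (vscale M (of_real r) v) = r * l v"
    using translation_functional[OF \<phi> aff] by metis
  have le: "lift_map \<phi> (x, {}) = ereal (l (- x))" for x
    by (simp add: lift_map_def l(1))
  have nM: "lift_map \<phi> z \<noteq> -\<infinity>" if "z \<in> points M" for z
    unfolding lift_map_def
    by (rule linear_map_not_MInf[OF \<phi>]) (use that in \<open>auto simp: points_def\<close>)
  have zero: "lift_map \<phi> (0, {}) = 0"
    by (simp add: lift_map_at_zero[OF aff] linear_map_zero[OF \<phi>])
  have hom: "lift_map \<phi> (0, hscale M (complex_of_real r) A) = ereal r * lift_map \<phi> (0, A)"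
    if "r \<in> posreals M" "A \<in> family M" for r A
    using that by (simp add: lift_map_at_zero[OF aff] linear_map_sc[OF \<phi>])
  have add: "lift_map \<phi> (0, A \<boxplus> B) = lift_map \<phi> (0, A) + lift_map \<phi> (0, B)"
    if "A \<in> family M" "B \<in> family M" for A B
    using that by (simp add: lift_map_at_zero[OF aff] linear_map_add[OF \<phi>])
  have vadd: "lift_map \<phi> (x + y, {}) = lift_map \<phi> (x, {}) + lift_map \<phi> (y, {})" for x y
    using l(2)[of "- x" "- y"] by (simp add: le)
  have vhom: "lift_map \<phi> (vscale M (complex_of_real r) x, {}) = ereal r * lift_map \<phi> (x, {})"
    if "complex_of_real r \<in> scalars M" for r x
    using l(3)[OF that, of "- x"] vscale_minus_right[OF that] by (simp add: le)
  have fin: "\<bar>lift_map \<phi> (x, {})\<bar> \<noteq> \<infinity>" for x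
    by (simp add: le)
  have mem: "(x, A) \<in> points M \<longleftrightarrow> A \<in> family M" for x A by (simp add: points_def)
  show ?thesis
    unfolding semilinear_on_def mem
  proof (intro conjI allI ballI impI; (elim conjE)?)
    show "\<not> (\<infinity> \<in> lift_map \<phi> ` points M \<and> -\<infinity> \<in> lift_map \<phi> ` points M)"
      using nM by fastforce
  qed (rule zero lift_map_translate hom fin vadd vhom add; assumption)+
qed

lemma lift_map_monotone:
  assumes \<phi>: "linear_map \<phi>" and aff: "translation_affine \<phi>"
    and mono: "\<And>A B. A \<in> family M \<Longrightarrow> B \<in> family M \<Longrightarrow> A \<sqsubseteq> B \<Longrightarrow> \<phi> A \<le> \<phi> B"
  shows "monotone_map M (lift_map \<phi>)"
  unfolding monotone_map_def
proof (intro ballI impI)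
  fix z w assume z: "z \<in> points M" "w \<in> points M" and le: "ple M z w"
  have "\<phi> (snd z) \<le> \<phi> (snd w)"
    using z le by (intro mono) (auto simp: points_def ple_def)
  then show "lift_map \<phi> z \<le> lift_map \<phi> w"
    using le unfolding lift_map_eq[OF aff z(1)] lift_map_eq[OF aff z(2)]
    by (simp add: ple_def add_left_mono)
qed

text \<open>
  Semilinearity only constrains \<open>h\<close> on the points \<open>(0, A)\<close> and \<open>(x, {})\<close> and under translations. That it
  makes \<open>h\<close> additive on all pairs is clear if \<open>v + {} = {v}\<close>. If \<open>v + {} = {}\<close>, it relies on monotonicity:
  \<open>h (x, {}) = 0\<close> for all \<open>x\<close>, so \<open>h (x, B) \<ge> 0\<close> whenever \<open>0 \<in> B\<close>, and after a translation this covers every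
  nonempty set. Hence \<open>h\<close> is nonnegative, and so translation invariant.
\<close>

lemma semilinear_eq_lift_map:
  assumes h: "semilinear_on M (points M) h" and mono: "monotone_map M h"
    and nM: "\<And>z. z \<in> points M \<Longrightarrow> h z \<noteq> -\<infinity>"
  defines "\<phi> \<equiv> \<lambda>A. h (0, A)"
  shows "linear_map \<phi>" "translation_affine \<phi>" "z \<in> points M \<Longrightarrow> h z = lift_map \<phi> z"
proof -
  have mem: "(x, A) \<in> points M \<longleftrightarrow> A \<in> family M" for x A by (simp add: points_def)
  note h' = h[unfolded semilinear_on_def mem]
  have zero: "h (0, {}) = 0" using h' by (rule conjunct1)
  have "\<forall>v x A. A \<in> family M \<and> translate M v A \<in> family M \<longrightarrow> h (v + x, translate M v A) = h (x, A)"
    and "\<forall>r\<in>posreals M. \<forall>A. A \<in> family M \<and> hscale M (complex_of_real r) A \<in> family M \<longrightarrow>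
      h (0, hscale M (complex_of_real r) A) = ereal r * h (0, A)"
    and "\<forall>A B. A \<in> family M \<and> B \<in> family M \<and> A \<boxplus> B \<in> family M \<longrightarrow> h (0, A \<boxplus> B) = h (0, A) + h (0, B)"
    using h' by - (elim conjE, assumption)+
  note conds = this[rule_format]
  have shift: "h (v + x, translate M v A) = h (x, A)" if "A \<in> family M" for v x A
    using that by (intro conds(1)) auto
  have hom: "h (0, hscale M (complex_of_real r) A) = ereal r * h (0, A)"
    if "r \<in> posreals M" "A \<in> family M" for r A
    using that by (intro conds(2)) auto
  have add: "h (0, A \<boxplus> B) = h (0, A) + h (0, B)" if "A \<in> family M" "B \<in> family M" for A B
    using that by (intro conds(3)) auto
  show lin: "linear_map \<phi>"
    unfolding linear_map_def \<phi>_def using zero add hom nM by (intro conjI ballI) (simp_all add: mem)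
  have lift: "h z = lift_map \<phi> z" if "z \<in> points M" for z
    using shift[of "snd z" "- fst z" "fst z"] that
    by (cases z) (simp add: \<phi>_def lift_map_def points_def)
  then show "z \<in> points M \<Longrightarrow> h z = lift_map \<phi> z" .
  consider "void M = (\<lambda>v. {})" | "void M = (\<lambda>v. {v})"
    using void_cases by blast
  then show "translation_affine \<phi>"
  proof cases
    case 1
    have nonneg: "0 \<le> \<phi> A" if A: "A \<in> family M" for A
    proof (cases "A = {}")
      case False
      then obtain a where a: "a \<in> A" by blast
      let ?B = "translate M (- a) A"
      have B: "?B \<in> family M" using A by simp
      have "0 \<in> ?B" using a False by (auto simp: translate_def intro!: image_eqI[of _ _ a])
      then have "{} \<sqsubseteq> ?B"
        using hle_hadd_zero[OF empty_closed B] zero_add[OF B] by simp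
      then have "h (- a, {}) \<le> h (- a, ?B)"
        using mono[unfolded monotone_map_def ple_def, rule_format, of "(- a, {})" "(- a, ?B)"] B
        by (simp add: mem)
      moreover have "h (- a, {}) = 0"
        using shift[of "{}" "- a" 0] zero 1 by (simp add: translate_def)
      moreover have "h (- a, ?B) = \<phi> A"
        using shift[OF A, of "- a" 0] by (simp add: \<phi>_def)
      ultimately show ?thesis by simp
    qed (simp add: \<phi>_def zero)
    show ?thesis
      by (rule translation_affine_invariant[OF 1 lin]) (rule nonneg_translation_invariant[OF 1 lin nonneg])
  next
    case 2
    have "\<phi> (translate M 0 {}) = 0"
      using shift[of "{}" 0 0] zero by (simp add: \<phi>_def)
    then show ?thesis by (rule translation_affine_singletons[OF 2 lin])
  qed
qed

end

section \<open>Estimates for \<open>\<xi>\<close>\<close>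

locale hahn_banach_problem = cancellative_space M for M :: "'x::topological_ab_group_add qspace" (structure) +
  fixes p :: "'x \<times> 'x set \<Rightarrow> ereal" and E :: "('x \<times> 'x set) set" and g :: "'x \<times> 'x set \<Rightarrow> real"
  assumes p: "sublinear M p"
    and subspace: "quasisemilinear_subspace M E"
    and g: "semilinear_subspace_map M E g"
    and xi: "sublinear_of_moderate_variation M (xi M E p g)"
begin

abbreviation \<xi> :: "'x \<times> 'x set \<Rightarrow> ereal" where "\<xi> \<equiv> xi M E p g"

abbreviation smul :: "real \<Rightarrow> 'x \<Rightarrow> 'x" (infixr "\<cdot>" 75) where
  "r \<cdot> x \<equiv> vscale M (complex_of_real r) x"

lemma hmultiple_hscale: "hmultiple M k (hscale M (complex_of_real a) A) = comb (replicate k a) A"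
  by (induction k) (simp_all add: hmultiple_def)

definition unfold_multiplicities :: "(nat \<times> real) list \<Rightarrow> real list" where
  "unfold_multiplicities ks = concat (map (\<lambda>(k, a). replicate k a) ks)"

lemma hcomb_eq_comb:
  assumes "\<forall>(k, a)\<in>set ks. 0 < k \<and> a \<in> posreals M" and "A \<in> family M"
  shows "hcomb M ks A = comb (unfold_multiplicities ks) A"
  using assms(1)
proof (induction ks)
  case Nil
  show ?case by (simp add: hcomb_def unfold_multiplicities_def)
next
  case (Cons x ks)
  obtain k a where x: "x = (k, a)" by (cases x)
  have "set (replicate k a) \<subseteq> posreals M" "set (unfold_multiplicities ks) \<subseteq> posreals M"
    using Cons.prems by (auto simp: x unfold_multiplicities_def)
  from comb_append'[OF this assms(2)] show ?case
    using Cons by (simp add: hcomb_def x unfold_multiplicities_def hmultiple_hscale)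
qed

lemma unfold_multiplicities_weights:
  assumes "\<forall>(k, a)\<in>set ks. 0 < k \<and> a \<in> posreals M" and "ks \<noteq> []"
  shows "unfold_multiplicities ks \<in> weights"
  using assms by (cases ks) (auto simp: weights_def unfold_multiplicities_def)

lemma sum_list_unfold_multiplicities:
  "sum_list (unfold_multiplicities ks) = (\<Sum>(k, a)\<leftarrow>ks. real k * a)"
  by (induction ks) (auto simp: unfold_multiplicities_def sum_list_replicate)

lemma unfold_multiplicities_ones: "unfold_multiplicities (map (\<lambda>r. (1, r)) rs) = rs"
  by (induction rs) (auto simp: unfold_multiplicities_def)

lemma E_family: "(y, B) \<in> E \<Longrightarrow> B \<in> family M"
  using subspace by (auto simp: quasisemilinear_subspace_def points_def)

text \<open>
  This rule and the next one form the universal property of \<open>\<xi>\<close>. Coefficient pairs \<open>(n, a)\<close>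
  are replaced by \<open>n\<close> copies of \<open>a\<close>, the summand \<open>C\<close> of a test relation has been cancelled, and the denominator has been cleared.
\<close>

lemma xi_test:
  assumes A: "A \<in> family M" and rs: "rs \<in> weights" and E: "(y, B) \<in> E" "(l, J) \<in> E" and G: "G \<in> family M"
    and vec: "y + sum_list rs \<cdot> x = l + m" and le: "B \<boxplus> comb rs A \<sqsubseteq> J \<boxplus> G"
  shows "ereal (sum_list rs) * \<xi> (x, A) + ereal (g (y, B)) \<le> p (m, G) + ereal (g (l, J))"
proof -
  let ?ks = "map (\<lambda>r. (1::nat, r)) rs"
  have ks: "\<forall>(k, a)\<in>set ?ks. 0 < k \<and> a \<in> posreals M" "?ks \<noteq> []"
    using rs by (auto simp: weights_def)
  have sum: "sum_list rs = (\<Sum>(k, a)\<leftarrow>?ks. real k * a)"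
    using sum_list_unfold_multiplicities[of ?ks] by (simp only: unfold_multiplicities_ones)
  have comb: "hcomb M ?ks A = comb rs A"
    using hcomb_eq_comb[OF ks(1) A] by (simp only: unfold_multiplicities_ones)
  have cl: "B \<boxplus> comb rs A \<in> family M" "J \<boxplus> G \<in> family M"
    using E_family[OF E(1)] E_family[OF E(2)] comb_closed[OF rs A] G by blast+
  have le': "B \<boxplus> hcomb M ?ks A \<boxplus> {} \<sqsubseteq> J \<boxplus> G \<boxplus> {}"
    unfolding comb hadd_empty[OF cl(1)] hadd_empty[OF cl(2)] by (rule le)
  have "test_relation M E (x, A) (sum_list rs) (y, B) (l, J) (m, G)"
    unfolding test_relation_def prod.case
    using E G ks sum vec le' empty_closed by blast
  then have "\<xi> (x, A) \<le> ereal (inverse (sum_list rs)) * (p (m, G) + ereal (g (l, J)) - ereal (g (y, B)))"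
    unfolding xi_def by (intro Inf_lower) blast
  then show ?thesis
    by (simp only: ereal_le_affine_iff[OF weight_pos[OF rs]])
qed

lemma le_xiI:
  assumes A: "A \<in> family M"
    and le: "\<And>rs y B l J m G. rs \<in> weights \<Longrightarrow> (y, B) \<in> E \<Longrightarrow> (l, J) \<in> E \<Longrightarrow> G \<in> family M \<Longrightarrow>
      y + sum_list rs \<cdot> x = l + m \<Longrightarrow> B \<boxplus> comb rs A \<sqsubseteq> J \<boxplus> G \<Longrightarrow>
      ereal (sum_list rs) * t + ereal (g (y, B)) \<le> p (m, G) + ereal (g (l, J))"
  shows "t \<le> \<xi> (x, A)"
  unfolding xi_def
proof (rule Inf_greatest, clarify)
  fix n y B l J m G
  assume "test_relation M E (x, A) n (y, B) (l, J) (m, G)"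
  then obtain C ks where E: "(y, B) \<in> E" "(l, J) \<in> E" and G: "G \<in> family M" and C: "C \<in> family M"
    and ks: "ks \<noteq> []" "\<forall>(k, a)\<in>set ks. 0 < k \<and> a \<in> posreals M"
    and n: "n = (\<Sum>(k, a)\<leftarrow>ks. real k * a)" and vec: "y + n \<cdot> x = l + m"
    and rel: "B \<boxplus> hcomb M ks A \<boxplus> C \<sqsubseteq> J \<boxplus> G \<boxplus> C"
    unfolding test_relation_def prod.case by blast
  let ?rs = "unfold_multiplicities ks"
  have rs: "?rs \<in> weights" by (rule unfold_multiplicities_weights[OF ks(2,1)])
  have sum: "sum_list ?rs = n" unfolding n by (rule sum_list_unfold_multiplicities)
  have "B \<boxplus> comb ?rs A \<boxplus> C \<sqsubseteq> J \<boxplus> G \<boxplus> C"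
    using rel unfolding hcomb_eq_comb[OF ks(2) A] .
  moreover have "B \<boxplus> comb ?rs A \<in> family M" "J \<boxplus> G \<in> family M"
    using E_family[OF E(1)] E_family[OF E(2)] comb_closed[OF rs A] G by blast+
  ultimately have "B \<boxplus> comb ?rs A \<sqsubseteq> J \<boxplus> G"
    using hle_cancel C by blast
  from le[OF rs E G _ this, of m] vec
  have "ereal n * t + ereal (g (y, B)) \<le> p (m, G) + ereal (g (l, J))"
    by (simp add: sum)
  then show "t \<le> ereal (inverse n) * (p (m, G) + ereal (g (l, J)) - ereal (g (y, B)))"
    using ereal_le_affine_iff[of n] weight_pos[OF rs] sum by simp
qed

lemma E_zero: "(0, {}) \<in> E" "g (0, {}) = 0"
proof -
  show "(0, {}) \<in> E" using subspace unfolding quasisemilinear_subspace_def by (elim conjE)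
  have "semilinear_on M E (\<lambda>z. ereal (g z))" using g unfolding semilinear_subspace_map_def by (elim conjE)
  then have "ereal (g (0, {})) = 0" unfolding semilinear_on_def by (elim conjE)
  then show "g (0, {}) = 0" by simp
qed

lemma E_padd:
  assumes "(y, B) \<in> E" "(l, J) \<in> E"
  shows "(y + l, B \<boxplus> J) \<in> E" "g (y + l, B \<boxplus> J) = g (y, B) + g (l, J)"
proof -
  have "\<forall>z\<in>E. \<forall>w\<in>E. padd M z w \<in> E"
    using subspace unfolding quasisemilinear_subspace_def by (elim conjE)
  from this[rule_format, OF assms] show "(y + l, B \<boxplus> J) \<in> E" by (simp add: padd_def)
  have "\<forall>z\<in>E. \<forall>w\<in>E. g (padd M z w) = g z + g w"
    using g unfolding semilinear_subspace_map_def by (elim conjE)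
  from this[rule_format, OF assms] show "g (y + l, B \<boxplus> J) = g (y, B) + g (l, J)" by (simp add: padd_def)
qed

lemma E_pscale:
  assumes r: "r \<in> posreals M" and E: "(y, B) \<in> E"
  shows "(r \<cdot> y, hscale M (of_real r) B) \<in> E" "g (r \<cdot> y, hscale M (of_real r) B) = r * g (y, B)"
proof -
  have "\<forall>a\<in>pscalars M. \<forall>z\<in>E. pscale M a z \<in> E"
    using subspace unfolding quasisemilinear_subspace_def by (elim conjE)
  from this[rule_format, OF posreals_pscalars[OF r] E]
  show "(r \<cdot> y, hscale M (of_real r) B) \<in> E" by (simp add: pscale_def)
  have "\<forall>r\<in>posreals M. \<forall>z\<in>E. g (pscale M (of_real r) z) = r * g z"
    using g unfolding semilinear_subspace_map_def by (elim conjE)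
  from this[rule_format, OF r E] show "g (r \<cdot> y, hscale M (of_real r) B) = r * g (y, B)"
    by (simp add: pscale_def)
qed

lemma E_comb:
  assumes rs: "rs \<in> weights" and E: "(y, B) \<in> E"
  shows "(sum_list rs \<cdot> y, comb rs B) \<in> E" "g (sum_list rs \<cdot> y, comb rs B) = sum_list rs * g (y, B)"
proof -
  have "set rs \<subseteq> posreals M \<Longrightarrow> complex_of_real (sum_list rs) \<in> scalars M \<and>
    (sum_list rs \<cdot> y, comb rs B) \<in> E \<and> g (sum_list rs \<cdot> y, comb rs B) = sum_list rs * g (y, B)"
  proof (induction rs)
    case Nil
    show ?case using E_zero scalars_zero_one by (simp add: vscale_zero_left)
  next
    case (Cons r rs)
    then have r: "r \<in> posreals M"
      and IH: "complex_of_real (sum_list rs) \<in> scalars M" "(sum_list rs \<cdot> y, comb rs B) \<in> E"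
        "g (sum_list rs \<cdot> y, comb rs B) = sum_list rs * g (y, B)" by auto
    have "(r + sum_list rs) \<cdot> y = r \<cdot> y + sum_list rs \<cdot> y"
      using vscale_left_add[OF posreals_scalars[OF r] IH(1)] by simp
    then show ?case
      using E_padd[OF E_pscale(1)[OF r E] IH(2)] E_pscale(2)[OF r E] IH(3)
        real_scalars_closed(1)[OF posreals_scalars[OF r] IH(1)]
      by (simp add: distrib_right)
  qed
  then show "(sum_list rs \<cdot> y, comb rs B) \<in> E" "g (sum_list rs \<cdot> y, comb rs B) = sum_list rs * g (y, B)"
    using weightsD[OF rs] by blast+
qed

lemma xi_le_p:
  assumes A: "A \<in> family M"
  shows "\<xi> (x, A) \<le> p (x, A)"
  using xi_test[OF A singleton_weights[OF Q_one] E_zero(1) E_zero(1) A, of x x] A E_zero(2)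
  by (simp add: zero_ereal_def[symmetric] one_ereal_def[symmetric])

lemma p_zero: "p (0, {}) = 0"
  using p unfolding sublinear_def by (elim conjE)

lemma xi_le_g:
  assumes E: "(y, B) \<in> E"
  shows "\<xi> (y, B) \<le> ereal (g (y, B))"
proof -
  have B: "B \<in> family M" by (rule E_family[OF E])
  show ?thesis
    using xi_test[OF B singleton_weights[OF Q_one] E_zero(1) E empty_closed, of y 0] B E_zero(2) p_zero
    by (simp add: zero_ereal_def[symmetric] one_ereal_def[symmetric])
qed

lemma xi_mono:
  assumes A: "A \<in> family M" "A' \<in> family M" and le: "A \<sqsubseteq> A'"
  shows "\<xi> (x, A) \<le> \<xi> (x, A')"
proof (rule le_xiI[OF A(2)])
  fix rs y B l J m G
  assume rs: "rs \<in> weights" and E: "(y, B) \<in> E" "(l, J) \<in> E" and G: "G \<in> family M"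
    and vec: "y + sum_list rs \<cdot> x = l + m" and rel: "B \<boxplus> comb rs A' \<sqsubseteq> J \<boxplus> G"
  have "set rs \<subseteq> posreals M \<Longrightarrow> comb rs A \<sqsubseteq> comb rs A'"
  proof (induction rs)
    case (Cons r rs)
    then have r: "r \<in> posreals M" and rs: "set rs \<subseteq> posreals M" by auto
    have "hscale M (of_real r) A \<sqsubseteq> hscale M (of_real r) A'"
      by (rule hscale_mono[OF posreals_pscalars[OF r] A le])
    from hle_hadd[OF sc_closed[OF r A(1)] sc_closed[OF r A(2)] comb_closed'[OF rs A(1)]
        comb_closed'[OF rs A(2)] conjI[OF this Cons.IH[OF rs]]]
    show ?case unfolding comb_Cons .
  qed simp
  then have comb_le: "comb rs A \<sqsubseteq> comb rs A'" using weightsD[OF rs] by blast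
  have fam: "B \<in> family M" "J \<in> family M" "comb rs A \<in> family M" "comb rs A' \<in> family M"
    using E_family[OF E(1)] E_family[OF E(2)] comb_closed[OF rs] A by blast+
  have "B \<boxplus> comb rs A \<sqsubseteq> B \<boxplus> comb rs A'"
    by (rule hle_hadd[OF fam(1) fam(1) fam(3) fam(4) conjI[OF hle_refl[OF fam(1)] comb_le]])
  from hle_trans[OF hadd_closed[OF fam(1,3)] hadd_closed[OF fam(1,4)] hadd_closed[OF fam(2) G] conjI[OF this rel]]
  have "B \<boxplus> comb rs A \<sqsubseteq> J \<boxplus> G" .
  from xi_test[OF A(1) rs E G vec this]
  show "ereal (sum_list rs) * \<xi> (x, A) + ereal (g (y, B)) \<le> p (m, G) + ereal (g (l, J))" .
qed

text \<open>
  A test relation for the formal sum of \<open>A\<close> is one for \<open>A\<close>, with a product of formal sums. The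
  converse inequality comes from sublinearity.
\<close>

lemma xi_comb_ge:
  assumes A: "A \<in> family M" and ss: "ss \<in> weights"
  shows "ereal (sum_list ss) * \<xi> (x, A) \<le> \<xi> (sum_list ss \<cdot> x, comb ss A)"
proof (rule le_xiI[OF comb_closed[OF ss A]])
  fix rs y B l J m G
  assume rs: "rs \<in> weights" and E: "(y, B) \<in> E" "(l, J) \<in> E" and G: "G \<in> family M"
    and vec: "y + sum_list rs \<cdot> sum_list ss \<cdot> x = l + m" and rel: "B \<boxplus> comb rs (comb ss A) \<sqsubseteq> J \<boxplus> G"
  let ?t = "times_weights rs ss"
  have t: "?t \<in> weights" using rs ss by (rule times_weights_closed)
  have "sum_list ?t \<cdot> x = sum_list rs \<cdot> sum_list ss \<cdot> x"
    using vscale_vscale[OF posreals_scalars[OF weight_posreals[OF rs]] posreals_scalars[OF weight_posreals[OF ss]]]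
    by (simp add: sum_list_times_weights)
  then have "y + sum_list ?t \<cdot> x = l + m" using vec by simp
  moreover have "B \<boxplus> comb ?t A \<sqsubseteq> J \<boxplus> G"
    using rel unfolding comb_comb[OF rs ss A] .
  ultimately have "ereal (sum_list ?t) * \<xi> (x, A) + ereal (g (y, B)) \<le> p (m, G) + ereal (g (l, J))"
    by (rule xi_test[OF A t E G])
  moreover have "ereal (sum_list ?t) * \<xi> (x, A) = ereal (sum_list rs) * (ereal (sum_list ss) * \<xi> (x, A))"
    unfolding sum_list_times_weights times_ereal.simps(1)[symmetric] by (rule mult.assoc)
  ultimately show "ereal (sum_list rs) * (ereal (sum_list ss) * \<xi> (x, A)) + ereal (g (y, B)) \<le>
      p (m, G) + ereal (g (l, J))" by simp
qed

text \<open>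
  In a test relation for the sum, the contribution of \<open>(y, B)\<close> can be counted as part of the point of
  \<open>E\<close> on the left side. This leaves a test relation for \<open>(x, A)\<close>.
\<close>

lemma xi_add_subspace_ge:
  assumes A: "A \<in> family M" and E: "(y, B) \<in> E"
  shows "\<xi> (x, A) + ereal (g (y, B)) \<le> \<xi> (x + y, A \<boxplus> B)"
proof (rule le_xiI[OF hadd_closed[OF A E_family[OF E]]])
  have B: "B \<in> family M" by (rule E_family[OF E])
  fix rs y' B' l J m G
  assume rs: "rs \<in> weights" and E': "(y', B') \<in> E" "(l, J) \<in> E" and G: "G \<in> family M"
    and vec: "y' + sum_list rs \<cdot> (x + y) = l + m" and rel: "B' \<boxplus> comb rs (A \<boxplus> B) \<sqsubseteq> J \<boxplus> G"
  have n: "complex_of_real (sum_list rs) \<in> scalars M"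
    by (rule posreals_scalars[OF weight_posreals[OF rs]])
  have cl: "B' \<in> family M" "comb rs A \<in> family M" "comb rs B \<in> family M"
    using E_family[OF E'(1)] comb_closed[OF rs] A B by auto
  have "(y' + sum_list rs \<cdot> y) + sum_list rs \<cdot> x = l + m"
    using vec by (simp add: vscale_right_add[OF n] ac_simps)
  moreover have "B' \<boxplus> comb rs (A \<boxplus> B) = (B' \<boxplus> comb rs B) \<boxplus> comb rs A"
    unfolding comb_add[OF rs A B] hadd_comm[OF cl(2,3)] by (rule hadd_assoc[OF cl(1,3,2), symmetric])
  with rel have "(B' \<boxplus> comb rs B) \<boxplus> comb rs A \<sqsubseteq> J \<boxplus> G" by (simp only:)
  ultimately have test: "ereal (sum_list rs) * \<xi> (x, A) + ereal (g (y' + sum_list rs \<cdot> y, B' \<boxplus> comb rs B)) \<le>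
      p (m, G) + ereal (g (l, J))"
    by (rule xi_test[OF A rs E_padd(1)[OF E'(1) E_comb(1)[OF rs E]] E'(2) G])
  have g_sum: "g (y' + sum_list rs \<cdot> y, B' \<boxplus> comb rs B) = g (y', B') + sum_list rs * g (y, B)"
    using E_padd(2)[OF E'(1) E_comb(1)[OF rs E]] E_comb(2)[OF rs E] by simp
  have "ereal (sum_list rs) * (\<xi> (x, A) + ereal (g (y, B))) + ereal (g (y', B')) =
      ereal (sum_list rs) * \<xi> (x, A) + ereal (g (y', B') + sum_list rs * g (y, B))"
    using weight_pos[OF rs] by (cases "\<xi> (x, A)") (simp_all add: algebra_simps)
  also have "\<dots> \<le> p (m, G) + ereal (g (l, J))"
    using test unfolding g_sum .
  finally show "ereal (sum_list rs) * (\<xi> (x, A) + ereal (g (y, B))) + ereal (g (y', B')) \<le>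
      p (m, G) + ereal (g (l, J))" .
qed

text \<open>
  Applying \<open>h\<close> to both sides of a test relation gives the estimate, once \<open>h\<close> is known to be additive on
  pairs.
\<close>

lemma HB_extension_le_xi:
  assumes h: "monotone_HB_extension M E p g h" and A: "A \<in> family M"
  shows "h (x, A) \<le> \<xi> (x, A)"
proof (rule le_xiI[OF A])
  have nM: "\<And>z. z \<in> points M \<Longrightarrow> h z \<noteq> -\<infinity>" and hg: "\<And>z. z \<in> E \<Longrightarrow> h z = ereal (g z)"
    and sl: "semilinear_on M (points M) h" and mono: "monotone_map M h"
    and hp: "\<And>z. z \<in> points M \<Longrightarrow> h z \<le> p z"
    using h by (simp_all add: monotone_HB_extension_def)
  define \<phi> where "\<phi> = (\<lambda>A. h (0, A))"
  have \<phi>: "linear_map \<phi>" "translation_affine \<phi>" and lift: "\<And>z. z \<in> points M \<Longrightarrow> h z = lift_map \<phi> z"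
    using semilinear_eq_lift_map[OF sl mono nM] unfolding \<phi>_def by blast+
  have mem: "(x, A) \<in> points M \<longleftrightarrow> A \<in> family M" for x A by (simp add: points_def)
  fix rs y B l J m G
  assume rs: "rs \<in> weights" and E: "(y, B) \<in> E" "(l, J) \<in> E" and G: "G \<in> family M"
    and vec: "y + sum_list rs \<cdot> x = l + m" and rel: "B \<boxplus> comb rs A \<sqsubseteq> J \<boxplus> G"
  have fam: "B \<in> family M" "J \<in> family M" "comb rs A \<in> family M"
    using E_family[OF E(1)] E_family[OF E(2)] comb_closed[OF rs A] by auto
  have add: "h (u + v, C \<boxplus> D) = h (u, C) + h (v, D)" if "C \<in> family M" "D \<in> family M" for u v C D
    using lift_map_padd[OF \<phi>, of "(u, C)" "(v, D)"] lift[of "(u, C)"] lift[of "(v, D)"]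
      lift[of "(u + v, C \<boxplus> D)"] that by (simp add: padd_def mem)
  have "ereal (sum_list rs) * h (x, A) + ereal (g (y, B)) = h (y, B) + h (sum_list rs \<cdot> x, comb rs A)"
    using lift_map_comb[OF \<phi> A rs, of x] lift[of "(x, A)"] lift[of "(sum_list rs \<cdot> x, comb rs A)"] fam A
      hg[OF E(1)] by (simp add: mem add.commute)
  also have "\<dots> = h (y + sum_list rs \<cdot> x, B \<boxplus> comb rs A)"
    by (rule add[OF fam(1,3), symmetric])
  also have "\<dots> \<le> h (l + m, J \<boxplus> G)"
    unfolding vec
    by (rule mono[unfolded monotone_map_def, rule_format])
      (use fam G rel in \<open>simp_all add: mem ple_def\<close>)
  also have "\<dots> = h (l, J) + h (m, G)" by (rule add[OF fam(2) G])
  also have "\<dots> \<le> p (m, G) + ereal (g (l, J))"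
    using hp[of "(m, G)"] G unfolding hg[OF E(2)] add.commute[of "ereal _"]
    by (intro add_right_mono) (simp add: mem)
  finally show "ereal (sum_list rs) * h (x, A) + ereal (g (y, B)) \<le> p (m, G) + ereal (g (l, J))" .
qed

lemma xi_sublinear: "sublinear M \<xi>"
  using xi unfolding sublinear_of_moderate_variation_def by (elim conjE)

lemma xi_sublinear_conditions:
  shows xi_zero: "\<xi> (0, {}) = 0"
    and xi_shift [rule_format]: "\<forall>v x. \<forall>A\<in>family M. \<xi> (v + x, translate M v A) = \<xi> (x, A)"
    and xi_subadditive [rule_format]:
      "\<forall>A\<in>family M. \<forall>B\<in>family M. \<xi> (0, A \<boxplus> B) \<le> \<xi> (0, A) + \<xi> (0, B)"
    and xi_homogeneous [rule_format]:
      "\<forall>r\<in>posreals M. \<forall>A\<in>family M. \<xi> (0, hscale M (of_real r) A) = ereal r * \<xi> (0, A)"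
  using xi_sublinear[unfolded sublinear_def] by - (elim conjE, assumption)+

lemma xi_hscale:
  assumes r: "r \<in> posreals M" and A: "A \<in> family M"
  shows "\<xi> (r \<cdot> x, hscale M (of_real r) A) = ereal r * \<xi> (x, A)"
proof -
  have "\<xi> (r \<cdot> x, hscale M (of_real r) A) = \<xi> (0, translate M (- (r \<cdot> x)) (hscale M (of_real r) A))"
    using xi_shift[OF sc_closed[OF r A], of "- (r \<cdot> x)" "r \<cdot> x"] by simp
  also have "translate M (- (r \<cdot> x)) (hscale M (of_real r) A) = hscale M (of_real r) (translate M (- x) A)"
    unfolding hscale_translate[OF r] vscale_minus_right[OF posreals_scalars[OF r]] ..
  also have "\<xi> (0, \<dots>) = ereal r * \<xi> (0, translate M (- x) A)"
    by (rule xi_homogeneous[OF r translate_closed[OF A]])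
  also have "\<xi> (0, translate M (- x) A) = \<xi> (x, A)"
    using xi_shift[OF A, of "- x" x] by simp
  finally show ?thesis .
qed

text \<open>
  The infimum in the definition of moderate variation may be \<open>\<infinity>\<close>; any real number below it will do.
\<close>

definition variation :: "'x set \<Rightarrow> real" where
  "variation A = (SOME c. \<forall>x. \<forall>B\<in>family M. ereal c + \<xi> (x, B) \<le> \<xi> (x, A \<boxplus> B))"

lemma xi_variation:
  assumes A: "A \<in> family M" and B: "B \<in> family M"
  shows "ereal (variation A) + \<xi> (x, B) \<le> \<xi> (x, A \<boxplus> B)"
proof -
  let ?I = "INF w\<in>points M. \<xi> (padd M (0, A) w) - \<xi> w"
  have nM: "\<xi> z \<noteq> -\<infinity>" if "z \<in> points M" for z
    using xi that unfolding sublinear_of_moderate_variation_def by blast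
  have "-\<infinity> < ?I"
    using xi A unfolding sublinear_of_moderate_variation_def points_def by (simp add: mem_Times_iff)
  then obtain c where c: "ereal c < ?I"
    using ereal_dense2 by blast
  have "ereal c + \<xi> (x, B) \<le> \<xi> (x, A \<boxplus> B)" if B: "B \<in> family M" for x B
  proof -
    have z: "(x, B) \<in> points M" "(x, A \<boxplus> B) \<in> points M" using A B by (auto simp: points_def)
    have "?I \<le> \<xi> (padd M (0, A) (x, B)) - \<xi> (x, B)"
      by (rule INF_lower[OF z(1)])
    with c have "ereal c \<le> \<xi> (x, A \<boxplus> B) - \<xi> (x, B)"
      by (simp add: padd_def)
    then show ?thesis
      using nM[OF z(1)] nM[OF z(2)]
      by (cases "\<xi> (x, B)"; cases "\<xi> (x, A \<boxplus> B)") (auto simp: algebra_simps)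
  qed
  then have "\<exists>c. \<forall>x. \<forall>B\<in>family M. ereal c + \<xi> (x, B) \<le> \<xi> (x, A \<boxplus> B)" by blast
  from someI_ex[OF this] show ?thesis
    unfolding variation_def using B by blast
qed

section \<open>The gauge \<open>\<zeta>\<close> on sets\<close>

text \<open>
  The vectors \<open>v\<close> with \<open>v + {} = 0 + {}\<close>. For them every monotone semilinear map takes equal values at
  \<open>(v, A)\<close> and \<open>(0, A)\<close>.
\<close>

definition stabilizer :: "'x set" where
  "stabilizer = (if void M = (\<lambda>v. {}) then UNIV else {0})"

lemma void_singleton: "void M \<noteq> (\<lambda>v. {}) \<Longrightarrow> void M = (\<lambda>v. {v})"
  using void_cases by blast

lemma zero_in_stabilizer: "0 \<in> stabilizer"
  by (simp add: stabilizer_def)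

lemma translate_empty_stabilizer: "v \<in> stabilizer \<Longrightarrow> translate M v {} = translate M 0 {}"
  by (simp add: stabilizer_def translate_def split: if_splits)

lemma xi_stabilizer_empty:
  assumes "v \<in> stabilizer"
  shows "\<xi> (v, {}) = 0"
proof (cases "void M = (\<lambda>v. {})")
  case True
  then show ?thesis
    using xi_shift[OF empty_closed, of v 0] xi_zero by (simp add: translate_def)
next
  case False
  then show ?thesis using assms xi_zero by (simp add: stabilizer_def)
qed

text \<open>
  Extensions \<open>h\<close> satisfy \<open>h (0, A) = h (v, A) \<le> \<xi> (v, A)\<close> for all \<open>v\<close> in the stabilizer, so this infimum bounds
  them from above. It is a gauge, while \<open>A \<mapsto> \<xi> (0, A)\<close> need not be translation invariant when all
  extensions are.
\<close>

definition \<zeta> :: "'x set \<Rightarrow> ereal" where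
  "\<zeta> A = (INF v\<in>stabilizer. \<xi> (v, A))"

lemma zeta_le: "v \<in> stabilizer \<Longrightarrow> \<zeta> A \<le> \<xi> (v, A)"
  unfolding \<zeta>_def by (rule INF_lower)

lemma le_zetaI: "(\<And>v. v \<in> stabilizer \<Longrightarrow> t \<le> \<xi> (v, A)) \<Longrightarrow> t \<le> \<zeta> A"
  unfolding \<zeta>_def by (rule INF_greatest)

lemma zeta_zero: "\<zeta> {} = 0"
proof (rule antisym)
  show "\<zeta> {} \<le> 0" using zeta_le[OF zero_in_stabilizer, of "{}"] by (simp add: xi_zero)
  show "0 \<le> \<zeta> {}" by (rule le_zetaI) (simp add: xi_stabilizer_empty)
qed

lemma zeta_variation:
  assumes "A \<in> family M" "B \<in> family M"
  shows "ereal (variation A) + \<zeta> B \<le> \<zeta> (A \<boxplus> B)"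
proof (rule le_zetaI)
  fix v assume v: "v \<in> stabilizer"
  have "ereal (variation A) + \<zeta> B \<le> ereal (variation A) + \<xi> (v, B)"
    by (intro add_left_mono zeta_le v)
  also have "\<dots> \<le> \<xi> (v, A \<boxplus> B)" by (rule xi_variation[OF assms])
  finally show "ereal (variation A) + \<zeta> B \<le> \<xi> (v, A \<boxplus> B)" .
qed

lemma zeta_not_MInf: "A \<in> family M \<Longrightarrow> \<zeta> A \<noteq> -\<infinity>"
  using zeta_variation[OF _ empty_closed, of A] zeta_zero by auto

lemma zeta_subadditive:
  assumes AB: "A \<in> family M" "B \<in> family M"
  shows "\<zeta> (A \<boxplus> B) \<le> \<zeta> A + \<zeta> B"
proof (cases "A = {} \<or> B = {}")
  case True
  then show ?thesis using AB by (auto simp: zeta_zero)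
next
  case False
  have "\<zeta> (A \<boxplus> B) \<le> Inf ((\<lambda>v. \<xi> (v, A)) ` stabilizer) + Inf ((\<lambda>v. \<xi> (v, B)) ` stabilizer)"
  proof (rule le_Inf_plus_Inf)
    fix s t assume "s \<in> (\<lambda>v. \<xi> (v, A)) ` stabilizer" "t \<in> (\<lambda>v. \<xi> (v, B)) ` stabilizer"
    then obtain u v where u: "u \<in> stabilizer" "s = \<xi> (u, A)" and v: "v \<in> stabilizer" "t = \<xi> (v, B)"
      by blast
    have uv: "u + v \<in> stabilizer" using u(1) v(1) by (auto simp: stabilizer_def split: if_splits)
    let ?A = "translate M (- u) A" and ?B = "translate M (- v) B"
    have "?A \<boxplus> ?B = translate M (- u) (A \<boxplus> ?B)"
      by (rule translate_hadd[symmetric]) (use AB False in auto)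
    also have "A \<boxplus> ?B = ?B \<boxplus> A" by (rule hadd_comm) (use AB in auto)
    also have "?B \<boxplus> A = translate M (- v) (B \<boxplus> A)"
      by (rule translate_hadd[symmetric]) (use AB False in auto)
    also have "B \<boxplus> A = A \<boxplus> B" by (rule hadd_comm) (use AB in auto)
    also have "translate M (- u) (translate M (- v) (A \<boxplus> B)) = translate M (- (u + v)) (A \<boxplus> B)"
      by (simp add: translate_translate)
    finally have eq: "?A \<boxplus> ?B = translate M (- (u + v)) (A \<boxplus> B)" .
    have at_zero: "\<xi> (x, C) = \<xi> (0, translate M (- x) C)" if "C \<in> family M" for x C
      using xi_shift[OF that, of "- x" x] by simp
    have "\<zeta> (A \<boxplus> B) \<le> \<xi> (u + v, A \<boxplus> B)" by (rule zeta_le[OF uv])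
    also have "\<dots> = \<xi> (0, ?A \<boxplus> ?B)" unfolding eq by (rule at_zero) (use AB in auto)
    also have "\<dots> \<le> \<xi> (0, ?A) + \<xi> (0, ?B)" by (rule xi_subadditive) (use AB in auto)
    also have "\<dots> = s + t" unfolding u v at_zero[OF AB(1), of u] at_zero[OF AB(2), of v] ..
    finally show "\<zeta> (A \<boxplus> B) \<le> s + t" .
  qed (use zeta_not_MInf[OF AB(1)] zeta_not_MInf[OF AB(2)] in \<open>simp_all add: \<zeta>_def\<close>)
  then show ?thesis by (simp add: \<zeta>_def)
qed

lemma zeta_hscale_le:
  assumes r: "r \<in> posreals M" and A: "A \<in> family M"
  shows "\<zeta> (hscale M (of_real r) A) \<le> ereal r * \<zeta> A"
proof -
  have pos: "0 < r" by (rule posreals_pos[OF r])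
  have "ereal (inverse r) * \<zeta> (hscale M (of_real r) A) \<le> \<zeta> A"
  proof (rule le_zetaI)
    fix v assume v: "v \<in> stabilizer"
    then have "r \<cdot> v \<in> stabilizer"
      using vscale_zero_right[OF posreals_scalars[OF r]] by (auto simp: stabilizer_def split: if_splits)
    then have "\<zeta> (hscale M (of_real r) A) \<le> ereal r * \<xi> (v, A)"
      using zeta_le xi_hscale[OF r A, of v] by metis
    then show "ereal (inverse r) * \<zeta> (hscale M (of_real r) A) \<le> \<xi> (v, A)"
      using pos by (cases "\<xi> (v, A)"; cases "\<zeta> (hscale M (of_real r) A)") (auto simp: field_simps)
  qed
  then show ?thesis
    using pos by (cases "\<zeta> A"; cases "\<zeta> (hscale M (of_real r) A)") (auto simp: field_simps)
qed

lemma zeta_comb: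
  assumes rs: "rs \<in> weights" and A: "A \<in> family M"
  shows "\<zeta> (comb rs A) = ereal (sum_list rs) * \<zeta> A"
proof (rule antisym)
  have "set rs \<subseteq> posreals M \<Longrightarrow> \<zeta> (comb rs A) \<le> ereal (sum_list rs) * \<zeta> A"
  proof (induction rs)
    case Nil
    show ?case by (simp add: zeta_zero flip: zero_ereal_def)
  next
    case (Cons r rs)
    then have r: "r \<in> posreals M" and rs: "set rs \<subseteq> posreals M" by auto
    have nn: "0 \<le> sum_list rs" using rs by (intro sum_list_nonneg) (auto dest: posreals_pos less_imp_le)
    have "\<zeta> (comb (r # rs) A) \<le> \<zeta> (hscale M (of_real r) A) + \<zeta> (comb rs A)"
      unfolding comb_Cons by (rule zeta_subadditive[OF sc_closed[OF r A] comb_closed'[OF rs A]])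
    also have "\<dots> \<le> ereal r * \<zeta> A + ereal (sum_list rs) * \<zeta> A"
      by (intro add_mono zeta_hscale_le[OF r A] Cons.IH[OF rs])
    also have "\<dots> = ereal (sum_list (r # rs)) * \<zeta> A"
      using nn posreals_pos[OF r] by (simp add: ereal_left_distrib flip: plus_ereal.simps)
    finally show ?case .
  qed
  then show "\<zeta> (comb rs A) \<le> ereal (sum_list rs) * \<zeta> A" using weightsD[OF rs] by blast
  show "ereal (sum_list rs) * \<zeta> A \<le> \<zeta> (comb rs A)"
  proof (rule le_zetaI)
    fix v assume v: "v \<in> stabilizer"
    let ?n = "sum_list rs"
    have n: "?n \<in> posreals M" by (rule weight_posreals[OF rs])
    let ?u = "inverse ?n \<cdot> v"
    have pos: "0 < ?n" by (rule posreals_pos[OF n])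
    have "(?n * inverse ?n) \<cdot> v = ?n \<cdot> ?u"
      unfolding of_real_mult
      by (rule vscale_vscale[OF posreals_scalars[OF n] posreals_scalars[OF Q_inverse[OF n]]])
    then have u: "?n \<cdot> ?u = v" using pos by simp
    have "?u \<in> stabilizer"
      using v vscale_zero_right[OF posreals_scalars[OF Q_inverse[OF n]]]
      by (auto simp: stabilizer_def split: if_splits)
    then have "ereal ?n * \<zeta> A \<le> ereal ?n * \<xi> (?u, A)"
      using pos zeta_le by (simp add: ereal_mult_le_mult_iff_pos)
    also have "\<dots> \<le> \<xi> (?n \<cdot> ?u, comb rs A)" by (rule xi_comb_ge[OF A rs])
    finally show "ereal ?n * \<zeta> A \<le> \<xi> (v, comb rs A)" unfolding u .
  qed
qed

text \<open>
  If \<open>v + {} = {}\<close>, all translates of a set are declared equivalent. Monotonicity for this relation then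
  expresses translation invariance, so that gauges and their linear minorants keep it.
\<close>

definition refined_le :: "'x set \<Rightarrow> 'x set \<Rightarrow> bool" where
  "refined_le A B \<longleftrightarrow> A \<in> family M \<and> B \<in> family M \<and>
     (A \<sqsubseteq> B \<or> void M = (\<lambda>v. {}) \<and> (\<exists>v. A = translate M v B))"

sublocale gauge_space "family M" "hadd M" "{}" "posreals M"
  "\<lambda>r. hscale M (complex_of_real r)" refined_le variation
proof
  fix A B assume R: "refined_le A B"
  then have fam: "A \<in> family M" "B \<in> family M" by (auto simp: refined_le_def)
  then show "A \<in> family M \<and> B \<in> family M" by blast
  from R consider "A \<sqsubseteq> B" | v where "void M = (\<lambda>v. {})" "A = translate M v B"
    unfolding refined_le_def by blast
  note R_cases = this
  show "refined_le (A \<boxplus> C) (B \<boxplus> C)" if C: "C \<in> family M" for C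
  proof -
    have cl: "A \<boxplus> C \<in> family M" "B \<boxplus> C \<in> family M" using fam C by auto
    from R_cases show ?thesis
    proof cases
      case 1
      then have "A \<boxplus> C \<sqsubseteq> B \<boxplus> C" using hle_cancel[OF fam C] by blast
      then show ?thesis using cl by (simp add: refined_le_def)
    next
      case (2 v)
      show ?thesis
      proof (cases "B = {}")
        case True
        then have "A = B" using 2 by (simp add: translate_def)
        then show ?thesis using cl by (simp add: refined_le_def)
      next
        case False
        have "A \<boxplus> C = translate M v (B \<boxplus> C)"
          unfolding 2(2) by (rule translate_hadd[OF fam(2) C False, symmetric])
        then show ?thesis using cl 2(1) unfolding refined_le_def by blast
      qed
    qed
  qed
  show "refined_le (hscale M (complex_of_real r) A) (hscale M (complex_of_real r) B)"
    if r: "r \<in> posreals M" for r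
  proof -
    note cl = sc_closed[OF r fam(1)] sc_closed[OF r fam(2)]
    from R_cases show ?thesis
    proof cases
      case 1
      from hscale_mono[OF posreals_pscalars[OF r] fam 1] cl show ?thesis
        by (simp add: refined_le_def)
    next
      case (2 v)
      have "hscale M (of_real r) A = translate M (r \<cdot> v) (hscale M (of_real r) B)"
        unfolding 2(2) by (rule hscale_translate[OF r])
      then show ?thesis using cl 2(1) unfolding refined_le_def by blast
    qed
  qed
qed

lemma gauge_zeta: "gauge \<zeta>"
proof -
  have "\<zeta> A \<le> \<zeta> B" if R: "refined_le A B" for A B
  proof (rule le_zetaI)
    fix v assume v: "v \<in> stabilizer"
    from R consider "A \<sqsubseteq> B" | u where "void M = (\<lambda>v. {})" "A = translate M u B"
      unfolding refined_le_def by blast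
    then show "\<zeta> A \<le> \<xi> (v, B)"
    proof cases
      case 1
      have "\<zeta> A \<le> \<xi> (v, A)" by (rule zeta_le[OF v])
      also have "\<dots> \<le> \<xi> (v, B)" using R 1 by (intro xi_mono) (auto simp: refined_le_def)
      finally show ?thesis .
    next
      case (2 u)
      have "\<zeta> A \<le> \<xi> (u + v, A)" by (rule zeta_le) (simp add: 2(1) stabilizer_def)
      also have "\<dots> = \<xi> (v, B)" unfolding 2(2) using R by (intro xi_shift) (simp add: refined_le_def)
      finally show ?thesis .
    qed
  qed
  then show ?thesis
    unfolding gauge_def
    by (intro conjI ballI allI impI zeta_zero zeta_subadditive zeta_comb zeta_variation)
qed

lemma zeta_translate_le:
  assumes "A \<in> family M"
  shows "\<zeta> (translate M (- x) A) \<le> \<xi> (x, A)"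
  using zeta_le[OF zero_in_stabilizer, of "translate M (- x) A"] xi_shift[OF assms, of "- x" x] by simp

text \<open>
  The point \<open>(y, B)\<close> of \<open>E\<close> corresponds to the set \<open>- y + B\<close>, and additivity of \<open>\<xi>\<close> in direction \<open>(y, B)\<close>
  becomes additivity of \<open>\<zeta>\<close> in direction \<open>- y + B\<close>. For \<open>B = {}\<close> and \<open>v + {} = {v}\<close> the translation rule for sums
  does not apply to the summand \<open>{}\<close>; it is applied to \<open>{0}\<close>, and \<open>A \<sqsubseteq> A \<boxplus> {0}\<close> removes the extra summand.
\<close>

lemma zeta_add_subspace_ge:
  assumes A: "A \<in> family M" and E: "(y, B) \<in> E"
  shows "\<zeta> A + ereal (g (y, B)) \<le> \<zeta> (A \<boxplus> translate M (- y) B)"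
proof (rule le_zetaI)
  fix v assume v: "v \<in> stabilizer"
  have B: "B \<in> family M" by (rule E_family[OF E])
  have shift: "\<xi> (v, A \<boxplus> translate M (- y) C) = \<xi> (v + y, A \<boxplus> C)" if C: "C \<in> family M" "C \<noteq> {}" for C
  proof -
    have "A \<boxplus> translate M (- y) C = translate M (- y) C \<boxplus> A"
      by (rule hadd_comm[OF A translate_closed[OF C(1)]])
    also have "\<dots> = translate M (- y) (C \<boxplus> A)" by (rule translate_hadd[OF C(1) A C(2), symmetric])
    also have "C \<boxplus> A = A \<boxplus> C" by (rule hadd_comm[OF C(1) A])
    finally show ?thesis
      using xi_shift[OF hadd_closed[OF A C(1)], of "- y" "v + y"] by simp
  qed
  have step: "\<zeta> A + ereal (g (y, B)) \<le> \<xi> (u, C)"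
    if "\<xi> (v', A) + ereal (g (y, B)) \<le> \<xi> (u, C)" "v' \<in> stabilizer" for v' u C
    using add_right_mono[OF zeta_le[OF that(2), of A]] that(1) by (rule order_trans)
  show "\<zeta> A + ereal (g (y, B)) \<le> \<xi> (v, A \<boxplus> translate M (- y) B)"
  proof (cases "B = {}")
    case False
    show ?thesis
      unfolding shift[OF B False] by (rule step[OF xi_add_subspace_ge[OF A E] v])
  next
    case True
    show ?thesis
    proof (cases "void M = (\<lambda>v. {})")
      case void: True
      then have "translate M (- y) B = B" by (simp add: True translate_def)
      moreover have "\<xi> (v - y, A) + ereal (g (y, B)) \<le> \<xi> (v, A \<boxplus> B)"
        using xi_add_subspace_ge[OF A E, of "v - y"] by simp
      ultimately show ?thesis
        using step[of "v - y" v "A \<boxplus> B"] void by (simp add: stabilizer_def)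
    next
      case False
      let ?o = "translate M 0 {}"
      have o: "?o \<noteq> {}" "0 \<in> ?o" using void_singleton[OF False] by (simp_all add: translate_def)
      have oS: "?o \<in> family M" by (rule translate_closed[OF empty_closed])
      have "translate M (- y) B = translate M (- y) ?o"
        by (simp add: True translate_translate)
      then have eq: "\<xi> (v, A \<boxplus> translate M (- y) B) = \<xi> (v + y, A \<boxplus> ?o)"
        using shift[OF oS o(1)] by simp
      have "\<xi> (v, A) + ereal (g (y, B)) \<le> \<xi> (v + y, A \<boxplus> B)"
        by (rule xi_add_subspace_ge[OF A E])
      also have "A \<boxplus> B = A" using A by (simp add: True)
      also have "\<xi> (v + y, A) \<le> \<xi> (v + y, A \<boxplus> ?o)"
        by (rule xi_mono[OF A hadd_closed[OF A oS] hle_hadd_zero[OF A oS o(2)]])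
      finally show ?thesis unfolding eq by (rule step[OF _ v])
    qed
  qed
qed

lemma zeta_subspace:
  assumes E: "(y, B) \<in> E"
  shows "translate M (- y) B \<in> additive_elements \<zeta>" "\<zeta> (translate M (- y) B) = ereal (g (y, B))"
proof -
  have B: "B \<in> family M" by (rule E_family[OF E])
  have "\<zeta> (translate M (- y) B) \<le> \<xi> (y, B)" by (rule zeta_translate_le[OF B])
  also have "\<dots> \<le> ereal (g (y, B))" by (rule xi_le_g[OF E])
  finally have le: "\<zeta> (translate M (- y) B) \<le> ereal (g (y, B))" .
  have "ereal (g (y, B)) \<le> \<zeta> ({} \<boxplus> translate M (- y) B)"
    using zeta_add_subspace_ge[OF empty_closed E] by (simp add: zeta_zero)
  also have "{} \<boxplus> translate M (- y) B = translate M (- y) B"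
    by (rule zero_add[OF translate_closed[OF B]])
  finally show eq: "\<zeta> (translate M (- y) B) = ereal (g (y, B))" using le by simp
  show "translate M (- y) B \<in> additive_elements \<zeta>"
    unfolding additive_elements_def mem_Collect_eq eq
    by (intro conjI ballI translate_closed[OF B] zeta_add_subspace_ge[OF _ E])
qed

lemma HB_extension_le_zeta:
  assumes h: "monotone_HB_extension M E p g h"
  shows "linear_map (\<lambda>A. h (0, A))" "\<And>z. z \<in> points M \<Longrightarrow> h z = h (0, translate M (- fst z) (snd z))"
    "\<And>A. A \<in> family M \<Longrightarrow> h (0, A) \<le> \<zeta> A"
proof -
  have nM: "\<And>z. z \<in> points M \<Longrightarrow> h z \<noteq> -\<infinity>" and sl: "semilinear_on M (points M) h"
    and mono: "monotone_map M h"
    using h by (simp_all add: monotone_HB_extension_def)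
  define \<phi> where "\<phi> = (\<lambda>A. h (0, A))"
  have \<phi>: "linear_map \<phi>" and aff: "translation_affine \<phi>"
    and lift: "\<And>z. z \<in> points M \<Longrightarrow> h z = lift_map \<phi> z"
    using semilinear_eq_lift_map[OF sl mono nM] unfolding \<phi>_def by blast+
  show "linear_map (\<lambda>A. h (0, A))" using \<phi> unfolding \<phi>_def .
  show "h z = h (0, translate M (- fst z) (snd z))" if "z \<in> points M" for z
    using lift[OF that] by (simp add: lift_map_def \<phi>_def)
  show "h (0, A) \<le> \<zeta> A" if A: "A \<in> family M" for A
  proof (rule le_zetaI)
    fix v assume v: "v \<in> stabilizer"
    have "- v \<in> stabilizer" using v by (simp add: stabilizer_def split: if_splits)
    then have "\<phi> (translate M (- v) {}) = 0"
      using aff by (simp add: translate_empty_stabilizer translation_affine_def)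
    then have "lift_map \<phi> (v, A) = \<phi> A"
      using lift_map_eq[OF aff, of "(v, A)"] A by (simp add: points_def)
    then have "h (0, A) = h (v, A)"
      using lift[of "(v, A)"] A by (simp add: points_def \<phi>_def)
    then show "h (0, A) \<le> \<xi> (v, A)" using HB_extension_le_xi[OF h A, of v] by simp
  qed
qed

lemma minorant_translation_affine:
  assumes \<phi>: "linear_map \<phi>" and mono: "\<And>A B. refined_le A B \<Longrightarrow> \<phi> A \<le> \<phi> B"
    and le: "\<And>A. A \<in> family M \<Longrightarrow> \<phi> A \<le> \<zeta> A"
  shows "translation_affine \<phi>"
proof (cases "void M = (\<lambda>v. {})")
  case True
  show ?thesis
  proof (rule translation_affine_invariant[OF True \<phi>])
    fix v A assume A: "A \<in> family M"
    have "A = translate M (- v) (translate M v A)"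
      using True by (cases "A = {}") (simp_all add: translate_translate translate_zero translate_def[of _ _ "{}"])
    then have "refined_le A (translate M v A)" "refined_le (translate M v A) A"
      unfolding refined_le_def using A True translate_closed[OF A] by blast+
    then show "\<phi> (translate M v A) = \<phi> A" using mono by (blast intro: antisym)
  qed
next
  case False
  let ?o = "translate M 0 {}"
  have oS: "?o \<in> family M" by (rule translate_closed[OF empty_closed])
  have "\<phi> ?o \<le> \<zeta> ?o" by (rule le[OF oS])
  also have "\<dots> \<le> \<xi> (0, {})" using zeta_translate_le[OF empty_closed, of 0] by simp
  finally have "\<phi> ?o \<le> 0" by (simp add: xi_zero)
  moreover have "0 \<in> ?o" using void_singleton[OF False] by (simp add: translate_def)
  then have "{} \<sqsubseteq> ?o" using hle_hadd_zero[OF empty_closed oS] zero_add[OF oS] by simp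
  then have "\<phi> {} \<le> \<phi> ?o" using oS by (intro mono) (simp add: refined_le_def)
  then have "0 \<le> \<phi> ?o" by (simp add: linear_map_zero[OF \<phi>])
  ultimately show ?thesis
    by (intro translation_affine_singletons[OF void_singleton[OF False] \<phi>]) simp
qed

section \<open>Maximal extensions\<close>

text \<open>
  A point \<open>z\<close> is represented by the set \<open>- fst z + snd z\<close>, at which linear maps below \<open>\<zeta>\<close> take the value
  of the induced map at \<open>z\<close>. In this way \<open>W\<close> becomes a set of directions for \<open>maximal_linear_minorant\<close>.
\<close>

theorem maximal_extension_exists:
  assumes W: "W \<subseteq> points M"
  shows "\<exists>h. maximal_monotone_HB_extension M E p g W h"
proof -
  let ?b = "\<lambda>z. translate M (- fst z) (snd z)"
  have b: "?b z \<in> family M" if "z \<in> points M" for z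
    using that by (auto simp: points_def)
  have bW: "?b ` W \<subseteq> family M" using b W by blast
  show ?thesis
  proof (rule maximal_linear_minorant[OF gauge_zeta bW])
    fix \<phi> assume \<phi>: "gauge \<phi>" "linear_map \<phi>" and le: "\<And>A. A \<in> family M \<Longrightarrow> \<phi> A \<le> \<zeta> A"
      and ext: "\<And>b. b \<in> additive_elements \<zeta> \<Longrightarrow> \<phi> b = \<zeta> b"
      and max: "\<And>h w. linear_map h \<Longrightarrow> (\<And>B. B \<in> family M \<Longrightarrow> h B \<le> \<zeta> B) \<Longrightarrow>
        (\<And>w. w \<in> ?b ` W \<Longrightarrow> \<phi> w \<le> h w) \<Longrightarrow> w \<in> ?b ` W \<Longrightarrow> h w = \<phi> w"
    have mono: "\<phi> A \<le> \<phi> B" if "refined_le A B" for A B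
      by (rule gauge_mono[OF \<phi>(1) that])
    have aff: "translation_affine \<phi>"
      by (rule minorant_translation_affine[OF \<phi>(2) mono le])
    let ?h = "lift_map \<phi>"
    have "monotone_HB_extension M E p g ?h"
      unfolding monotone_HB_extension_def
    proof (intro conjI ballI)
      fix z assume z: "z \<in> points M"
      then have A: "snd z \<in> family M" by (auto simp: points_def)
      show "?h z \<noteq> -\<infinity>" unfolding lift_map_def by (rule linear_map_not_MInf[OF \<phi>(2) b[OF z]])
      have "?h z \<le> \<zeta> (?b z)" unfolding lift_map_def by (rule le[OF b[OF z]])
      also have "\<dots> \<le> \<xi> (fst z, snd z)" by (rule zeta_translate_le[OF A])
      also have "\<dots> \<le> p (fst z, snd z)" by (rule xi_le_p[OF A])
      finally show "?h z \<le> p z" by simp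
    next
      fix z assume z: "z \<in> E"
      have "(fst z, snd z) \<in> E" using z by simp
      from zeta_subspace[OF this] show "?h z = ereal (g z)"
        unfolding lift_map_def by (simp add: ext)
    next
      show "semilinear_on M (points M) ?h" by (rule lift_map_semilinear[OF \<phi>(2) aff])
      show "monotone_map M ?h"
        by (rule lift_map_monotone[OF \<phi>(2) aff mono]) (simp add: refined_le_def)
    qed
    moreover have "h' w = ?h w"
      if h': "monotone_HB_extension M E p g h'" and ge: "\<forall>w\<in>W. ?h w \<le> h' w" and w: "w \<in> W" for h' w
    proof -
      note facts = HB_extension_le_zeta[OF h']
      have eq: "h' w = h' (0, ?b w)" if "w \<in> W" for w by (rule facts(2)[OF subsetD[OF W that]])
      have "h' (0, ?b w) = \<phi> (?b w)"
      proof (rule max[OF facts(1,3)])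
        fix c assume "c \<in> ?b ` W"
        then obtain w' where w': "w' \<in> W" "c = ?b w'" by blast
        then have "?h w' \<le> h' w'" using ge by blast
        then show "\<phi> c \<le> h' (0, c)" unfolding eq[OF w'(1)] w'(2) lift_map_def .
      qed (assumption | rule imageI[OF w])+
      then show ?thesis using eq[OF w] by (simp add: lift_map_def)
    qed
    ultimately show ?thesis unfolding maximal_monotone_HB_extension_def by blast
  qed
qed

end

theorem theorem2p14:
  fixes M :: "'x::topological_ab_group_add qspace"
    and p :: "'x \<times> 'x set \<Rightarrow> ereal"
    and E :: "('x \<times> 'x set) set"
    and g :: "'x \<times> 'x set \<Rightarrow> real"
  assumes "quasisemilinear_preordered_space M"
    and "monotonely_cancellative M"
    and "sublinear M p"
    and "\<forall>z\<in>points M. p z \<noteq> -\<infinity>"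
    and "quasisemilinear_subspace M E"
    and "semilinear_subspace_map M E g"
    and "sublinear_of_moderate_variation M (xi M E p g)"
  shows "\<forall>W. W \<subseteq> points M \<longrightarrow> (\<exists>h. maximal_monotone_HB_extension M E p g W h)"
proof -
  interpret hahn_banach_problem M p E g
    by unfold_locales (fact assms)+
  show ?thesis using maximal_extension_exists by blast
qed

end
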